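(* Let $\Sigma\in\mathbb{R}^{k\times k}$ be symmetric positive definite, and assume there is at least one allocation $\underline n$ satisfying $\mathbf{B}(\underline n)$ with $\operatorname{supp}(a)\subseteq\bigcup\{I\in\mathcal I:n_I>0\}$. Then \[ \inf_{\hat\theta\in\Theta_B}\ \sup_{P\in\mathcal P_\Sigma}\ \mathbb{E}_P\big[(\hat\theta-a^\top\mathbb{E}_P[X])^2\big]\;=\;\operatorname{Var}\big(\hat\theta_{\mathrm{MultiPPI}(\Sigma)}\big)\;=\;\mathcal V_B, \] where the variance is computed under any $P\in\mathcal P_\Sigma$ (it is the same for all such $P$).
   Context: Let $X=(X_1,\dots,X_k)$ be a random vector in $\mathbb{R}^k$ with finite second moments, and fix $a\in\mathbb{R}^k$, $a\neq 0$; the target is $\theta^*=a^\top\mathbb{E}[X]$. Fix a collection $\mathcal I$ of nonempty subsets $I\subseteq\{1,\dots,k\}$. For $I\in\mathcal I$, $P_I:\mathbb{R}^k\to\mathbb{R}^{|I|}$ is the coordinate projection onto the coordinates in $I$ (so $P_I^\top$ is zero-padding), $X_I=P_IX$, and $\Sigma_I=P_I\Sigma P_I^\top$ (principal submatrix). Each $I$ has a cost vector $c_I\in\mathbb{R}^m_{\ge0}$ and there is a budget $B\in\mathbb{R}^m_{\ge0}$; vector inequalities are componentwise. An allocation is $\underline n=(n_I)_{I\in\mathcal I}$ with $n_I\in\mathbb{Z}_{\ge0}$; it satisfies the budget, written $\mathbf{B}(\underline n)$, if $\sum_{I}n_Ic_I\le B$. Given $\underline n$, the data are $\{X_I^{(I,j)}:I\in\mathcal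 I,\,1\le j\le n_I\}$, where the $X^{(I,j)}$ are mutually independent copies of $X$ and only the coordinates $I$ of $X^{(I,j)}$ are observed. A budget-satisfying estimator is any measurable function of such data for some $\underline n$ with $\mathbf{B}(\underline n)$; $\Theta_B$ denotes the set of all of them (no linearity or unbiasedness imposed). $\mathcal P_\Sigma$ is the set of all distributions on $\mathbb{R}^k$ with covariance matrix $\Sigma$. For weights $\underline\lambda=(\lambda_I)_{I\in\mathcal I}$, $\lambda_I\in\mathbb{R}^{|I|}$, define $\hat\theta(\underline n,\underline\lambda)=\sum_{I:n_I>0}\frac1{n_I}\sum_{j=1}^{n_I}\lambda_I^\top X_I^{(I,j)}$. The unbiasedness condition $\mathbf U(\underline n,\underline\lambda)$ is $\sum_{I:n_I>0}P_I^\top\lambda_I=a$ (equivalently, $\mathbb{E}\hat\theta(\underline n,\underline\lambda)=a^\top\mathbb{E}X$ for every distribution with finite second moments). $\hat\theta_{\mathrm{MultiPPI}(\Sigma)}$ is $\hat\theta(\underline n,\underline\lambda)$ for a pair $(\underline n,\underline\lambda)$ minimizing $\sum_{I:n_I>0}\frac1{n_I}\lambda_I^\top\Sigma_I\lambda_I$ subject to $\mathbf B(\underline n)$ and $\mathbf U(\underline n,\underline\lambda)$. Finally \[ \mathcal V_B=\min\Big\{a^\top S(\underline n)a:\ \underline n\in\mathbb{Z}_{\ge0}^{\mathcal I},\ \mathbf B(\underline n),\ \operatorname{supp}(a)\subseteq\textstyle\bigcup\{I:n_I>0\}\Big\},\qquad S(\underline n)=\Big(\sum_{I\in\mathcal I}n_IP_I^\top\Sigma_I^{-1}P_I\Big)^\dagger,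 \] with $\dagger$ the Moore–Penrose pseudo-inverse.
   Formalization: Since zero costs are allowed, the minimum defining V_B and the MultiPPI minimizer may fail to exist; V_B is taken as the infimum, and the variance identity is stated for every minimizing pair (n, λ), whenever one exists. *)

theory Defs
  imports "HOL-Probability.Probability"
begin

(* Coordinates {1..k} are the finite type 'k; a vector in R^k is real^'k.
   Cost vectors / budget live in R^m, i.e. real^'m.  A subset I of the
   coordinates is a 'k set; the collection \<I> is a 'k set set. *)

definition mp_pinv :: "real^'n^'n \<Rightarrow> real^'n^'n" where
  "mp_pinv A = (THE X. A ** X ** A = A \<and> X ** A ** X = X \<and>
                       transpose (A ** X) = A ** X \<and> transpose (X ** A) = X ** A)"

(* P_I^T \<Sigma>_I^{-1} P_I : inverse of the principal submatrix on I, zero-padded *)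
definition pad_sub_inv :: "real^'k^'k \<Rightarrow> 'k set \<Rightarrow> real^'k^'k" where
  "pad_sub_inv S I = (THE M. (\<forall>i j. (i \<notin> I \<or> j \<notin> I) \<longrightarrow> M $ i $ j = 0) \<and>
       (\<forall>i\<in>I. \<forall>j\<in>I. (\<Sum>l\<in>I. M $ i $ l * S $ l $ j) = (if i = j then 1 else 0)))"

definition budget_ok :: "'k set set \<Rightarrow> ('k set \<Rightarrow> real^'m) \<Rightarrow> real^'m \<Rightarrow> ('k set \<Rightarrow> nat) \<Rightarrow> bool" where
  "budget_ok \<I> c B n \<longleftrightarrow> (\<forall>m. (\<Sum>I\<in>\<I>. real (n I) * c I $ m) \<le> B $ m)"

definition covers_supp :: "'k set set \<Rightarrow> real^'k \<Rightarrow> ('k set \<Rightarrow> nat) \<Rightarrow> bool" where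
  "covers_supp \<I> a n \<longleftrightarrow> (\<forall>i. a $ i \<noteq> 0 \<longrightarrow> (\<exists>I\<in>\<I>. 0 < n I \<and> i \<in> I))"

definition S_mat :: "'k set set \<Rightarrow> real^'k^'k \<Rightarrow> ('k set \<Rightarrow> nat) \<Rightarrow> real^'k^'k" where
  "S_mat \<I> \<Sigma> n = mp_pinv (\<Sum>I\<in>\<I>. real (n I) *\<^sub>R pad_sub_inv \<Sigma> I)"

(* V_B (the min in the paper, rendered as the infimum) *)
definition V_B :: "'k set set \<Rightarrow> ('k set \<Rightarrow> real^'m) \<Rightarrow> real^'m \<Rightarrow> real^'k^'k \<Rightarrow> real^'k \<Rightarrow> real" where
  "V_B \<I> c B \<Sigma> a = Inf {a \<bullet> (S_mat \<I> \<Sigma> n *v a) | n. budget_ok \<I> c B n \<and> covers_supp \<I> a n}"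

definition mean_vec :: "(real^'k) measure \<Rightarrow> real^'k" where
  "mean_vec P = (\<chi> i. \<integral>x. x $ i \<partial>P)"

definition dists_cov :: "real^'k^'k \<Rightarrow> (real^'k) measure set" where
  "dists_cov \<Sigma> = {P. prob_space P \<and> sets P = sets borel \<and>
      (\<forall>i. integrable P (\<lambda>x. (x $ i)\<^sup>2)) \<and>
      (\<forall>i j. (\<integral>x. (x $ i - mean_vec P $ i) * (x $ j - mean_vec P $ j) \<partial>P) = \<Sigma> $ i $ j)}"

(* index set of the independent copies X^{(I,j)}, I \<in> \<I>, 1 \<le> j \<le> n_I (here 0 \<le> j < n_I) *)
definition copies :: "'k set set \<Rightarrow> ('k set \<Rightarrow> nat) \<Rightarrow> ('k set \<times> nat) set" where
  "copies \<I> n = {(I, j). I \<in> \<I> \<and> j < n I}"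

definition obs_idx :: "'k set set \<Rightarrow> ('k set \<Rightarrow> nat) \<Rightarrow> ('k set \<times> nat \<times> 'k) set" where
  "obs_idx \<I> n = {(I, j, i). I \<in> \<I> \<and> j < n I \<and> i \<in> I}"

definition copies_law :: "'k set set \<Rightarrow> ('k set \<Rightarrow> nat) \<Rightarrow> (real^'k) measure \<Rightarrow> ('k set \<times> nat \<Rightarrow> real^'k) measure" where
  "copies_law \<I> n P = PiM (copies \<I> n) (\<lambda>_. P)"

definition observe :: "'k set set \<Rightarrow> ('k set \<Rightarrow> nat) \<Rightarrow> ('k set \<times> nat \<Rightarrow> real^'k) \<Rightarrow> ('k set \<times> nat \<times> 'k \<Rightarrow> real)" where
  "observe \<I> n \<omega> = (\<lambda>(I, j, i) \<in> obs_idx \<I> n. \<omega> (I, j) $ i)"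

definition budget_estimators :: "'k set set \<Rightarrow> ('k set \<Rightarrow> real^'m) \<Rightarrow> real^'m \<Rightarrow>
    (('k set \<Rightarrow> nat) \<times> (('k set \<times> nat \<times> 'k \<Rightarrow> real) \<Rightarrow> real)) set" where
  "budget_estimators \<I> c B = {(n, f). budget_ok \<I> c B n \<and>
      f \<in> borel_measurable (PiM (obs_idx \<I> n) (\<lambda>_. borel))}"

definition mse :: "'k set set \<Rightarrow> real^'k \<Rightarrow> ('k set \<Rightarrow> nat) \<Rightarrow> (('k set \<times> nat \<times> 'k \<Rightarrow> real) \<Rightarrow> real)
    \<Rightarrow> (real^'k) measure \<Rightarrow> ennreal" where
  "mse \<I> a n f P = (\<integral>\<^sup>+ \<omega>. ennreal ((f (observe \<I> n \<omega>) - a \<bullet> mean_vec P)\<^sup>2) \<partial>copies_law \<I> n P)"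

(* \<theta>hat(n, \<lambda>); \<lambda>_I \<in> R^{|I|} is represented zero-padded, i.e. as P_I^T \<lambda>_I \<in> R^k *)
definition theta_hat :: "'k set set \<Rightarrow> ('k set \<Rightarrow> nat) \<Rightarrow> ('k set \<Rightarrow> real^'k) \<Rightarrow> ('k set \<times> nat \<Rightarrow> real^'k) \<Rightarrow> real" where
  "theta_hat \<I> n lam \<omega> = (\<Sum>I\<in>{I\<in>\<I>. 0 < n I}. (1 / real (n I)) *
       (\<Sum>j<n I. \<Sum>i\<in>I. lam I $ i * \<omega> (I, j) $ i))"

definition weights_ok :: "'k set set \<Rightarrow> ('k set \<Rightarrow> real^'k) \<Rightarrow> bool" where
  "weights_ok \<I> lam \<longleftrightarrow> (\<forall>I\<in>\<I>. \<forall>i. i \<notin> I \<longrightarrow> lam I $ i = 0)"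

definition unbiased_ok :: "'k set set \<Rightarrow> real^'k \<Rightarrow> ('k set \<Rightarrow> nat) \<Rightarrow> ('k set \<Rightarrow> real^'k) \<Rightarrow> bool" where
  "unbiased_ok \<I> a n lam \<longleftrightarrow> (\<Sum>I\<in>{I\<in>\<I>. 0 < n I}. lam I) = a"

definition ppi_obj :: "'k set set \<Rightarrow> real^'k^'k \<Rightarrow> ('k set \<Rightarrow> nat) \<Rightarrow> ('k set \<Rightarrow> real^'k) \<Rightarrow> real" where
  "ppi_obj \<I> \<Sigma> n lam = (\<Sum>I\<in>{I\<in>\<I>. 0 < n I}. (1 / real (n I)) *
       (\<Sum>i\<in>I. \<Sum>j\<in>I. lam I $ i * \<Sigma> $ i $ j * lam I $ j))"

definition ppi_feasible where
  "ppi_feasible \<I> c B a n lam \<longleftrightarrow> budget_ok \<I> c B n \<and> weights_ok \<I> lam \<and> unbiased_ok \<I> a n lam"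

definition multippi_opt :: "'k set set \<Rightarrow> ('k set \<Rightarrow> real^'m) \<Rightarrow> real^'m \<Rightarrow> real^'k^'k \<Rightarrow> real^'k
    \<Rightarrow> ('k set \<Rightarrow> nat) \<Rightarrow> ('k set \<Rightarrow> real^'k) \<Rightarrow> bool" where
  "multippi_opt \<I> c B \<Sigma> a n lam \<longleftrightarrow> ppi_feasible \<I> c B a n lam \<and>
     (\<forall>n' lam'. ppi_feasible \<I> c B a n' lam' \<longrightarrow> ppi_obj \<I> \<Sigma> n lam \<le> ppi_obj \<I> \<Sigma> n' lam')"

end

theory Submission
  imports Defs
begin

text \<open>
  Upper bound: with \<open>F = \<Sum>\<^sub>I n\<^sub>I P\<^sub>I\<^sup>T \<Sigma>\<^sub>I\<^sup>-\<^sup>1 P\<^sub>I\<close> and \<open>s = S(n) a\<close> one has \<open>F s = a\<close> whenever \<open>n\<close> covers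
  the support of \<open>a\<close>, so the weights \<open>\<lambda>\<^sub>I = n\<^sub>I \<Sigma>\<^sub>I\<^sup>-\<^sup>1 s\<^sub>I\<close> are unbiased, and their variance is \<open>s \<bullet> F s = a \<bullet> s\<close>.

  Lower bound: restrict to the Gaussian laws \<open>N(t u, \<Sigma>)\<close> with \<open>a \<bullet> u = 1\<close>. The likelihood ratio of the
  observed data with respect to \<open>t = 0\<close> is \<open>exp (t T - t\<^sup>2 J / 2)\<close> with \<open>J = u \<bullet> F u\<close>. Averaging the risk over
  \<open>t\<close> with the weight \<open>exp (- \<epsilon> t\<^sup>2 / 2)\<close>, exchanging the integrals and bounding the integral over \<open>t\<close> from
  below by the variance of a Gaussian gives the bound \<open>1 / (J + \<epsilon>)\<close>. The direction \<open>u = s / (a \<bullet> s)\<close> has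
  \<open>J = 1 / (a \<bullet> s)\<close>; if some coordinate with \<open>a\<^sub>i \<noteq> 0\<close> is never observed, then \<open>J = 0\<close> is possible and the
  risk is infinite. Applied to the MultiPPI estimator itself, whose risk is constant, the lower bound
  also shows that no feasible pair has an objective below \<open>V_B\<close>.
\<close>

section \<open>Product measures and Gaussian shifts\<close>

text \<open>Expanding the product of the two sums leaves a double sum in which the off-diagonal
  terms vanish by independence and centring. This gives both the variance of
  \<open>theta_hat\<close> and the covariance of a linear image of a standard normal vector.\<close>

lemma (in prob_space) centered_sum_products:
  fixes g h :: "'i \<Rightarrow> 'a \<Rightarrow> real"
  assumes fin: "finite I"
    and g: "\<And>i. i \<in> I \<Longrightarrow> integrable M (g i)" "\<And>i. i \<in> I \<Longrightarrow> expectation (g i) = 0"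
    and h: "\<And>i. i \<in> I \<Longrightarrow> integrable M (h i)" "\<And>i. i \<in> I \<Longrightarrow> expectation (h i) = 0"
    and gh: "\<And>i. i \<in> I \<Longrightarrow> integrable M (\<lambda>x. g i x * h i x)"
  shows "has_bochner_integral (PiM I (\<lambda>_. M))
           (\<lambda>\<omega>. (\<Sum>i\<in>I. g i (\<omega> i)) * (\<Sum>i\<in>I. h i (\<omega> i)))
           (\<Sum>i\<in>I. expectation (\<lambda>x. g i x * h i x))"
proof -
  interpret Q: product_prob_space "\<lambda>_. M" I
    by (rule product_prob_spaceI) (rule prob_space_axioms)
  have pair: "has_bochner_integral (PiM I (\<lambda>_. M)) (\<lambda>\<omega>. g i (\<omega> i) * h j (\<omega> j))
      (if i = j then expectation (\<lambda>x. g i x * h i x) else 0)" if ij: "i \<in> I" "j \<in> I" for i j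
  proof -
    \<comment> \<open>Padding with factors 1 turns \<open>g i\<close> times \<open>h j\<close> into
      a product over all of \<open>I\<close>, as the product integral requires. For
      \<open>i = j\<close> both factors sit at the same index, so the two cases share one
      formula.\<close>
    define F where "F l = (\<lambda>x. (if l = i then g i x else 1) * (if l = j then h j x else 1))" for l
    have F_int: "integrable M (F l)" for l
      unfolding F_def using g(1)[OF ij(1)] h(1)[OF ij(2)] gh[OF ij(1)]
      by (cases "l = i"; cases "l = j") auto
    have prod_F: "(\<Prod>l\<in>I. F l (\<omega> l)) = g i (\<omega> i) * h j (\<omega> j)" for \<omega>
      using fin ij by (simp add: F_def prod.distrib prod.delta)
    have int_F: "(\<Prod>l\<in>I. integral\<^sup>L M (F l)) = (if i = j then expectation (\<lambda>x. g i x * h i x) else 0)"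
    proof (cases "i = j")
      case True
      have "integral\<^sup>L M (F l) = (if l = i then expectation (\<lambda>x. g i x * h i x) else 1)" for l
        using True by (simp add: F_def prob_space)
      then show ?thesis using fin ij True by (simp add: prod.delta)
    next
      case False
      then have "integral\<^sup>L M (F i) = 0" using g(2)[OF ij(1)] by (simp add: F_def)
      then show ?thesis using False fin ij(1) by auto
    qed
    show ?thesis
      using Q.product_integrable_prod[OF fin, of F] Q.product_integral_prod[OF fin, of F] F_int
      unfolding has_bochner_integral_iff prod_F int_F by simp
  qed
  have "has_bochner_integral (PiM I (\<lambda>_. M)) (\<lambda>\<omega>. \<Sum>i\<in>I. \<Sum>j\<in>I. g i (\<omega> i) * h j (\<omega> j))
      (\<Sum>i\<in>I. \<Sum>j\<in>I. if i = j then expectation (\<lambda>x. g i x * h i x) else 0)"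
    by (intro has_bochner_integral_sum pair)
  then show ?thesis using fin by (simp add: sum_product)
qed

lemma integrable_mult_of_squares:
  fixes f g :: "'a \<Rightarrow> real"
  assumes [measurable]: "f \<in> borel_measurable M" "g \<in> borel_measurable M"
    and "integrable M (\<lambda>x. (f x)\<^sup>2)" "integrable M (\<lambda>x. (g x)\<^sup>2)"
  shows "integrable M (\<lambda>x. f x * g x)"
proof (rule Bochner_Integration.integrable_bound)
  show "integrable M (\<lambda>x. (f x)\<^sup>2 + (g x)\<^sup>2)" using assms by simp
  have "\<bar>a * b\<bar> \<le> a\<^sup>2 + b\<^sup>2" for a b :: real
  proof -
    have "2 * (\<bar>a\<bar> * \<bar>b\<bar>) \<le> a\<^sup>2 + b\<^sup>2" using sum_squares_bound[of "\<bar>a\<bar>" "\<bar>b\<bar>"] by simp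
    moreover have "0 \<le> \<bar>a\<bar> * \<bar>b\<bar>" by simp
    ultimately show ?thesis unfolding abs_mult by linarith
  qed
  then show "AE x in M. norm (f x * g x) \<le> norm ((f x)\<^sup>2 + (g x)\<^sup>2)"
    by (auto intro: order_trans[OF _ abs_ge_self])
qed measurable

text \<open>Preimages of boxes are boxes, and the values on boxes determine a product of finitely
  many probability measures.\<close>

lemma distr_PiM_componentwise:
  fixes M :: "'a measure" and K :: "'b measure"
  assumes fin: "finite I" and M: "prob_space M"
    and f[measurable]: "\<And>i. f i \<in> measurable M K"
  shows "distr (PiM I (\<lambda>_. M)) (PiM I (\<lambda>_. K)) (\<lambda>\<omega>. \<lambda>i\<in>I. f i (\<omega> i))
    = PiM I (\<lambda>i. distr M K (f i))"
proof -
  interpret M: product_prob_space "\<lambda>_. M" I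
    by (rule product_prob_spaceI) (rule M)
  interpret N: product_prob_space "\<lambda>i. distr M K (f i)" I
    by (rule product_prob_spaceI) (intro prob_space.prob_space_distr M f)
  show ?thesis
  proof (rule N.PiM_eqI[OF fin])
    show "sets (distr (PiM I (\<lambda>_. M)) (PiM I (\<lambda>_. K)) (\<lambda>\<omega>. \<lambda>i\<in>I. f i (\<omega> i)))
        = sets (PiM I (\<lambda>i. distr M K (f i)))"
      by (simp, rule sets_PiM_cong) auto
    fix A assume A: "\<And>i. i \<in> I \<Longrightarrow> A i \<in> sets (distr M K (f i))"
    have "(\<lambda>\<omega>. \<lambda>i\<in>I. f i (\<omega> i)) -` (Pi\<^sub>E I A) \<inter> space (PiM I (\<lambda>_. M))
        = Pi\<^sub>E I (\<lambda>i. f i -` A i \<inter> space M)"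
      by (auto simp: space_PiM PiE_iff)
    then show "emeasure (distr (PiM I (\<lambda>_. M)) (PiM I (\<lambda>_. K)) (\<lambda>\<omega>. \<lambda>i\<in>I. f i (\<omega> i))) (Pi\<^sub>E I A)
        = (\<Prod>i\<in>I. emeasure (distr M K (f i)) (A i))"
      using A fin by (subst emeasure_distr)
        (auto intro!: sets_PiM_I_finite prod.cong simp: emeasure_distr M.emeasure_PiM measurable_sets[OF f])
  qed
qed

text \<open>On a box the integrand splits into factors depending on one coordinate each, so the
  integral is a product: the likelihood ratio of independent data is the product of the individual
  ratios.\<close>

lemma density_PiM:
  fixes M :: "'a measure"
  assumes fin: "finite I" and M: "prob_space M"
    and L[measurable]: "\<And>i. L i \<in> borel_measurable M"
    and prob: "\<And>i. prob_space (density M (L i))"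
  shows "density (PiM I (\<lambda>_. M)) (\<lambda>\<omega>. \<Prod>i\<in>I. L i (\<omega> i)) = PiM I (\<lambda>i. density M (L i))"
proof -
  interpret M: product_prob_space "\<lambda>_. M" I
    by (rule product_prob_spaceI) (rule M)
  interpret N: product_prob_space "\<lambda>i. density M (L i)" I
    by (rule product_prob_spaceI) (rule prob)
  show ?thesis
  proof (rule N.PiM_eqI[OF fin])
    show "sets (density (PiM I (\<lambda>_. M)) (\<lambda>\<omega>. \<Prod>i\<in>I. L i (\<omega> i))) = sets (PiM I (\<lambda>i. density M (L i)))"
      by (simp, rule sets_PiM_cong) auto
    fix A assume A: "\<And>i. i \<in> I \<Longrightarrow> A i \<in> sets (density M (L i))"
    have "Pi\<^sub>E I A \<in> sets (PiM I (\<lambda>_. M))" using A fin by (auto intro: sets_PiM_I_finite)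
    then have "emeasure (density (PiM I (\<lambda>_. M)) (\<lambda>\<omega>. \<Prod>i\<in>I. L i (\<omega> i))) (Pi\<^sub>E I A)
        = (\<integral>\<^sup>+\<omega>. (\<Prod>i\<in>I. L i (\<omega> i)) * indicator (Pi\<^sub>E I A) \<omega> \<partial>PiM I (\<lambda>_. M))"
      by (subst emeasure_density) (auto intro!: borel_measurable_prod_ennreal)
    also have "\<dots> = (\<integral>\<^sup>+\<omega>. (\<Prod>i\<in>I. L i (\<omega> i) * indicator (A i) (\<omega> i)) \<partial>PiM I (\<lambda>_. M))"
      using fin by (intro nn_integral_cong)
        (auto simp: prod.distrib indicator_def space_PiM PiE_iff)
    also have "\<dots> = (\<Prod>i\<in>I. \<integral>\<^sup>+x. L i x * indicator (A i) x \<partial>M)"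
      using A fin by (intro M.product_nn_integral_prod) auto
    also have "\<dots> = (\<Prod>i\<in>I. emeasure (density M (L i)) (A i))"
      using A by (intro prod.cong refl) (auto simp: emeasure_density)
    finally show "emeasure (density (PiM I (\<lambda>_. M)) (\<lambda>\<omega>. \<Prod>i\<in>I. L i (\<omega> i))) (Pi\<^sub>E I A)
        = (\<Prod>i\<in>I. emeasure (density M (L i)) (A i))" .
  qed
qed

text \<open>Lifts a shift formula from one factor to a product. It is used twice: from the line to a
  standard normal vector, and from one vector to all copies in the sample.\<close>

lemma distr_PiM_eq_density:
  fixes M :: "'a measure"
  assumes "finite I" "prob_space M"
    and s: "\<And>i. s i \<in> measurable M M" and L: "\<And>i. L i \<in> borel_measurable M"
    and eq: "\<And>i. distr M M (s i) = density M (L i)"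
  shows "distr (PiM I (\<lambda>_. M)) (PiM I (\<lambda>_. M)) (\<lambda>\<omega>. \<lambda>i\<in>I. s i (\<omega> i))
    = density (PiM I (\<lambda>_. M)) (\<lambda>\<omega>. \<Prod>i\<in>I. L i (\<omega> i))"
proof -
  have "prob_space (density M (L i))" for i
    unfolding eq[symmetric] by (intro prob_space.prob_space_distr assms)
  then show ?thesis
    using assms by (simp add: distr_PiM_componentwise density_PiM)
qed

section \<open>Gaussian shifts on the line and the Bayes risk bound\<close>

abbreviation std_normal :: "real measure" where
  "std_normal \<equiv> density lborel std_normal_density"

text \<open>The one-dimensional Cameron-Martin formula: the normal density at \<open>x - h\<close>
  divided by that at \<open>x\<close> is \<open>exp (h * x - h\<^sup>2 / 2)\<close>.\<close>

lemma distr_std_normal_shift: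
  "distr std_normal std_normal (\<lambda>x. x + h) = density std_normal (\<lambda>x. ennreal (exp (h * x - h\<^sup>2 / 2)))"
proof (rule measure_eqI)
  fix A assume "A \<in> sets (distr std_normal std_normal (\<lambda>x. x + h))"
  then have [measurable]: "A \<in> sets borel" by simp
  have "emeasure (distr std_normal std_normal (\<lambda>x. x + h)) A
      = (\<integral>\<^sup>+x. indicator A (x + h) \<partial>std_normal)"
    by (simp add: nn_integral_distr flip: nn_integral_indicator)
  also have "\<dots> = (\<integral>\<^sup>+x. ennreal (std_normal_density x) * indicator A (x + h) \<partial>lborel)"
    by (subst nn_integral_density) auto
  also have "\<dots> = (\<integral>\<^sup>+x. ennreal (std_normal_density (x - h)) * indicator A x \<partial>lborel)"
    by (subst nn_integral_real_affine[where c = 1 and t = "- h"]) simp_all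
  also have "\<dots> = (\<integral>\<^sup>+x. ennreal (std_normal_density x) * (ennreal (exp (h * x - h\<^sup>2 / 2)) * indicator A x) \<partial>lborel)"
  proof (rule nn_integral_cong)
    fix x :: real
    have "std_normal_density (x - h) = std_normal_density x * exp (h * x - h\<^sup>2 / 2)"
      by (simp add: std_normal_density_def exp_add[symmetric] power2_eq_square field_simps)
    then show "ennreal (std_normal_density (x - h)) * indicator A x
        = ennreal (std_normal_density x) * (ennreal (exp (h * x - h\<^sup>2 / 2)) * indicator A x)"
      by (simp add: ennreal_mult mult.assoc)
  qed
  also have "\<dots> = emeasure (density std_normal (\<lambda>x. ennreal (exp (h * x - h\<^sup>2 / 2)))) A"
    by (subst emeasure_density, simp, simp, subst nn_integral_density) auto
  finally show "emeasure (distr std_normal std_normal (\<lambda>x. x + h)) A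
      = emeasure (density std_normal (\<lambda>x. ennreal (exp (h * x - h\<^sup>2 / 2)))) A" .
qed simp

text \<open>Expanding around the mean gives exactly
  \<open>\<sigma>\<^sup>2 + (z - \<mu>)\<^sup>2\<close>, so no guess \<open>z\<close> does better
  than the mean itself.\<close>

lemma gaussian_variance_ge:
  fixes z \<mu> \<sigma> :: real
  assumes \<sigma>: "0 < \<sigma>"
  shows "ennreal (\<sigma>\<^sup>2) \<le> (\<integral>\<^sup>+t. ennreal ((z - t)\<^sup>2 * normal_density \<mu> \<sigma> t) \<partial>lborel)"
proof -
  have "has_bochner_integral lborel (\<lambda>t. normal_density \<mu> \<sigma> t * (t - \<mu>)^2) (\<sigma>\<^sup>2)"
    using normal_moment_even[OF \<sigma>, of \<mu> 1] by simp
  moreover have "has_bochner_integral lborel (\<lambda>t. normal_density \<mu> \<sigma> t * (t - \<mu>)) 0"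
    using normal_moment_odd[OF \<sigma>, of \<mu> 0] by simp
  moreover have "has_bochner_integral lborel (normal_density \<mu> \<sigma>) 1"
    using normal_moment_even[OF \<sigma>, of \<mu> 0] by simp
  ultimately have "has_bochner_integral lborel (\<lambda>t. normal_density \<mu> \<sigma> t * (t - \<mu>)^2
      + normal_density \<mu> \<sigma> t * (t - \<mu>) * (- 2 * (z - \<mu>)) + normal_density \<mu> \<sigma> t * (z - \<mu>)\<^sup>2)
      (\<sigma>\<^sup>2 + 0 * (- 2 * (z - \<mu>)) + 1 * (z - \<mu>)\<^sup>2)"
    by (intro has_bochner_integral_add has_bochner_integral_mult_left)
  also have "(\<lambda>t. normal_density \<mu> \<sigma> t * (t - \<mu>)^2
      + normal_density \<mu> \<sigma> t * (t - \<mu>) * (- 2 * (z - \<mu>)) + normal_density \<mu> \<sigma> t * (z - \<mu>)\<^sup>2)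
      = (\<lambda>t. (z - t)\<^sup>2 * normal_density \<mu> \<sigma> t)"
    by (auto simp: power2_eq_square algebra_simps)
  finally have "has_bochner_integral lborel (\<lambda>t. (z - t)\<^sup>2 * normal_density \<mu> \<sigma> t) (\<sigma>\<^sup>2 + (z - \<mu>)\<^sup>2)"
    by simp
  then have "(\<integral>\<^sup>+t. ennreal ((z - t)\<^sup>2 * normal_density \<mu> \<sigma> t) \<partial>lborel) = ennreal (\<sigma>\<^sup>2 + (z - \<mu>)\<^sup>2)"
    by (simp add: has_bochner_integral_iff nn_integral_eq_integral)
  then show ?thesis by (simp add: ennreal_leI)
qed

text \<open>Completing the square shows that the exponential is \<open>w\<close> times the normal
  density with mean \<open>T / K\<close> and variance \<open>1 / K\<close>. It acts as an
  unnormalised posterior for \<open>t\<close>, and \<open>z\<close> is the estimate made from the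
  data.\<close>

lemma exp_quadratic_moment_ge:
  fixes T K z :: real
  assumes K: "0 < K"
  shows "ennreal (1 / K) * (\<integral>\<^sup>+t. ennreal (exp (t * T - t\<^sup>2 * K / 2)) \<partial>lborel)
    \<le> (\<integral>\<^sup>+t. ennreal ((z - t)\<^sup>2 * exp (t * T - t\<^sup>2 * K / 2)) \<partial>lborel)"
proof -
  define \<mu> \<sigma> w where "\<mu> = T / K" and "\<sigma> = sqrt (1 / K)"
    and "w = exp (T\<^sup>2 / (2 * K)) * sqrt (2 * pi * \<sigma>\<^sup>2)"
  have \<sigma>: "0 < \<sigma>" and \<sigma>2: "\<sigma>\<^sup>2 = 1 / K" using K by (auto simp: \<sigma>_def)
  have w: "0 \<le> w" by (simp add: w_def)
  have sq: "sqrt (2 * pi * \<sigma>\<^sup>2) > 0" using \<sigma> by simp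
  have "exp (t * T - t\<^sup>2 * K / 2) = exp (T\<^sup>2 / (2 * K)) * exp (- (t - \<mu>)\<^sup>2 / (2 * \<sigma>\<^sup>2))" for t
    unfolding exp_add[symmetric] \<sigma>2 \<mu>_def using K
    by (simp add: field_simps power2_eq_square)
  then have e: "exp (t * T - t\<^sup>2 * K / 2) = w * normal_density \<mu> \<sigma> t" for t
    using sq \<sigma> unfolding w_def normal_density_def by simp
  have "(\<integral>\<^sup>+t. ennreal (exp (t * T - t\<^sup>2 * K / 2)) \<partial>lborel) = ennreal w"
    unfolding e using w \<sigma>
    by (simp add: ennreal_mult nn_integral_cmult nn_integral_eq_integral)
  moreover have "(\<integral>\<^sup>+t. ennreal ((z - t)\<^sup>2 * exp (t * T - t\<^sup>2 * K / 2)) \<partial>lborel)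
      = ennreal w * (\<integral>\<^sup>+t. ennreal ((z - t)\<^sup>2 * normal_density \<mu> \<sigma> t) \<partial>lborel)"
    unfolding e using w
    by (subst nn_integral_cmult[symmetric]) (auto simp: ennreal_mult[symmetric] mult_ac)
  ultimately show ?thesis
    using mult_left_mono[OF gaussian_variance_ge[OF \<sigma>, of z \<mu>], of "ennreal w"] \<sigma>2
    by (simp add: mult.commute)
qed

text \<open>The bound \<open>b\<close> on the risk for every \<open>t\<close> also bounds the
  average risk under a Gaussian prior of precision \<open>\<epsilon>\<close>. The posterior
  precision is \<open>J + \<epsilon>\<close> whatever the data, so the average risk is at least its
  inverse. Allowing \<open>J = 0\<close> matters for targets that the data do not determine.\<close>

lemma gaussian_shift_minimax:
  fixes T g :: "'a \<Rightarrow> real"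
  assumes \<Gamma>: "prob_space \<Gamma>" and [measurable]: "T \<in> borel_measurable \<Gamma>" "g \<in> borel_measurable \<Gamma>"
    and J: "0 \<le> J" and \<epsilon>: "0 < \<epsilon>"
    and norm: "\<And>t. (\<integral>\<^sup>+\<omega>. ennreal (exp (t * T \<omega> - t\<^sup>2 * J / 2)) \<partial>\<Gamma>) = 1"
    and risk: "\<And>t. (\<integral>\<^sup>+\<omega>. ennreal ((g \<omega> - t)\<^sup>2) * ennreal (exp (t * T \<omega> - t\<^sup>2 * J / 2)) \<partial>\<Gamma>) \<le> b"
  shows "ennreal (1 / (J + \<epsilon>)) \<le> b"
proof -
  interpret \<Gamma>: prob_space \<Gamma> by (rule \<Gamma>)
  interpret pair_sigma_finite \<Gamma> lborel ..
  \<comment> \<open>The prior stays unnormalised; its mass \<open>W\<close> is shown to be positive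
    and finite so that it can be cancelled at the end.\<close>
  define p where "p t = ennreal (exp (- t\<^sup>2 * \<epsilon> / 2))" for t :: real
  define W where "W = (\<integral>\<^sup>+t. p t \<partial>lborel)"
  have [measurable]: "p \<in> borel_measurable borel" unfolding p_def by measurable
  define \<sigma> where "\<sigma> = sqrt (1 / \<epsilon>)"
  have \<sigma>: "0 < \<sigma>" using \<epsilon> by (simp add: \<sigma>_def)
  have \<sigma>2: "\<sigma>\<^sup>2 = 1 / \<epsilon>" using \<epsilon> by (simp add: \<sigma>_def)
  have "p t = ennreal (sqrt (2 * pi * \<sigma>\<^sup>2)) * ennreal (normal_density 0 \<sigma> t)" for t
    unfolding p_def normal_density_def using \<sigma> \<epsilon>
    by (subst ennreal_mult[symmetric]) (auto simp: \<sigma>2)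
  then have W_eq: "W = ennreal (sqrt (2 * pi * \<sigma>\<^sup>2))"
    unfolding W_def using \<sigma> by (simp add: nn_integral_cmult nn_integral_eq_integral cong: nn_integral_cong)
  have exp_split: "ennreal (exp (t * x - t\<^sup>2 * J / 2)) * p t = ennreal (exp (t * x - t\<^sup>2 * (J + \<epsilon>) / 2))" for t x
    unfolding p_def by (subst ennreal_mult[symmetric]) (auto simp: exp_add[symmetric] field_simps)
  \<comment> \<open>By \<open>norm\<close> the likelihood ratio can be inserted as a factor of
    integral 1. The order of integration is then exchanged, the inner integral over \<open>t\<close>
    is bounded for each fixed outcome, and a second exchange brings the risk back.\<close>
  have "ennreal (1 / (J + \<epsilon>)) * W
      = ennreal (1 / (J + \<epsilon>)) * (\<integral>\<^sup>+t. \<integral>\<^sup>+\<omega>. ennreal (exp (t * T \<omega> - t\<^sup>2 * J / 2)) * p t \<partial>\<Gamma> \<partial>lborel)"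
    by (simp add: nn_integral_multc norm W_def)
  also have "(\<integral>\<^sup>+t. \<integral>\<^sup>+\<omega>. ennreal (exp (t * T \<omega> - t\<^sup>2 * J / 2)) * p t \<partial>\<Gamma> \<partial>lborel)
      = (\<integral>\<^sup>+\<omega>. \<integral>\<^sup>+t. ennreal (exp (t * T \<omega> - t\<^sup>2 * J / 2)) * p t \<partial>lborel \<partial>\<Gamma>)"
    by (rule Fubini') measurable
  also have "ennreal (1 / (J + \<epsilon>)) * \<dots>
      = (\<integral>\<^sup>+\<omega>. ennreal (1 / (J + \<epsilon>)) * (\<integral>\<^sup>+t. ennreal (exp (t * T \<omega> - t\<^sup>2 * (J + \<epsilon>) / 2)) \<partial>lborel) \<partial>\<Gamma>)"
    unfolding exp_split by (rule nn_integral_cmult[symmetric]) measurable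
  also have "\<dots> \<le> (\<integral>\<^sup>+\<omega>. (\<integral>\<^sup>+t. ennreal ((g \<omega> - t)\<^sup>2 * exp (t * T \<omega> - t\<^sup>2 * (J + \<epsilon>) / 2)) \<partial>lborel) \<partial>\<Gamma>)"
    using J \<epsilon> by (intro nn_integral_mono exp_quadratic_moment_ge) auto
  also have "\<dots> = (\<integral>\<^sup>+\<omega>. (\<integral>\<^sup>+t. ennreal ((g \<omega> - t)\<^sup>2) * ennreal (exp (t * T \<omega> - t\<^sup>2 * J / 2)) * p t \<partial>lborel) \<partial>\<Gamma>)"
    by (simp add: ennreal_mult mult.assoc exp_split)
  also have "\<dots> = (\<integral>\<^sup>+t. (\<integral>\<^sup>+\<omega>. ennreal ((g \<omega> - t)\<^sup>2) * ennreal (exp (t * T \<omega> - t\<^sup>2 * J / 2)) * p t \<partial>\<Gamma>) \<partial>lborel)"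
    by (rule Fubini'[symmetric]) measurable
  also have "\<dots> \<le> (\<integral>\<^sup>+t. b * p t \<partial>lborel)"
    by (intro nn_integral_mono) (simp add: nn_integral_multc risk mult_right_mono)
  also have "\<dots> = b * W" by (simp add: nn_integral_cmult W_def)
  finally have "ennreal (1 / (J + \<epsilon>)) * W \<le> b * W" .
  moreover have "0 < W" "W < \<top>" using \<sigma> by (auto simp: W_eq)
  ultimately show ?thesis
    by (metis ennreal_mult_le_mult_iff mult.commute less_numeral_extra(3) less_irrefl top.not_eq_extremum)
qed

section \<open>Padded inverses and the Moore--Penrose inverse\<close>

text \<open>Induction on the index set: splitting off \<open>k\<close> leaves the Schur complement
  \<open>S'\<close>, which is again symmetric and positive definite.\<close>

lemma cholesky:
  fixes S :: "'k \<Rightarrow> 'k \<Rightarrow> real"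
  assumes "finite K"
    and "\<And>i j. i \<in> K \<Longrightarrow> j \<in> K \<Longrightarrow> S i j = S j i"
    and "\<And>x. \<exists>i\<in>K. x i \<noteq> 0 \<Longrightarrow> 0 < (\<Sum>i\<in>K. \<Sum>j\<in>K. x i * S i j * x j)"
  shows "\<exists>A. \<forall>i\<in>K. \<forall>j\<in>K. (\<Sum>r\<in>K. A i r * A j r) = S i j"
  using assms
proof (induction K arbitrary: S rule: finite_induct)
  case empty
  then show ?case by simp
next
  case (insert k K)
  define d where "d = S k k"
  define S' where "S' i j = S i j - S k i * S k j / d" for i j
  have quad: "(\<Sum>i\<in>insert k K. \<Sum>j\<in>insert k K. y i * S i j * y j)
      = d * (y k)\<^sup>2 + 2 * y k * (\<Sum>i\<in>K. S k i * y i) + (\<Sum>i\<in>K. \<Sum>j\<in>K. y i * S i j * y j)" for y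
  proof -
    have "(\<Sum>i\<in>K. y i * S i k * y k) = y k * (\<Sum>i\<in>K. S k i * y i)"
      unfolding sum_distrib_left using insert.prems(1) by (intro sum.cong) auto
    moreover have "(\<Sum>j\<in>K. y k * S k j * y j) = y k * (\<Sum>i\<in>K. S k i * y i)"
      unfolding sum_distrib_left by (intro sum.cong) auto
    ultimately show ?thesis
      using insert.hyps by (simp add: sum.distrib d_def power2_eq_square)
  qed
  have d: "0 < d"
    using insert.prems(2)[of "\<lambda>i. if i = k then 1 else 0"] insert.hyps(2)
    unfolding quad by (auto simp: if_distrib sum.neutral cong: if_cong)
  have "\<exists>A. \<forall>i\<in>K. \<forall>j\<in>K. (\<Sum>r\<in>K. A i r * A j r) = S' i j"
  proof (rule insert.IH)
    show "S' i j = S' j i" if "i \<in> K" "j \<in> K" for i j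
      using that insert.prems(1) by (simp add: S'_def mult.commute)
    fix x :: "'k \<Rightarrow> real"
    assume x: "\<exists>i\<in>K. x i \<noteq> 0"
    define L where "L = (\<Sum>i\<in>K. S k i * x i)"
    \<comment> \<open>This value at \<open>k\<close> minimises the quadratic form of
      \<open>S\<close> over that coordinate, and the minimum is the form of \<open>S'\<close> at
      \<open>x\<close>.\<close>
    define y where "y i = (if i = k then - L / d else x i)" for i
    have yK: "y i = x i" if "i \<in> K" for i using that insert.hyps(2) by (auto simp: y_def)
    have "0 < (\<Sum>i\<in>insert k K. \<Sum>j\<in>insert k K. y i * S i j * y j)"
      using x yK by (intro insert.prems(2)) auto
    also have "\<dots> = d * (y k)\<^sup>2 + 2 * y k * L + (\<Sum>i\<in>K. \<Sum>j\<in>K. x i * S i j * x j)"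
      unfolding quad L_def by (simp add: yK cong: sum.cong)
    also have "\<dots> = (\<Sum>i\<in>K. \<Sum>j\<in>K. x i * S i j * x j) - L * L / d"
      using d by (simp add: y_def power2_eq_square field_simps)
    also have "L * L / d = (\<Sum>i\<in>K. \<Sum>j\<in>K. x i * (S k i * S k j / d) * x j)"
      unfolding L_def sum_product sum_divide_distrib by (intro sum.cong refl) simp
    also have "(\<Sum>i\<in>K. \<Sum>j\<in>K. x i * S i j * x j) - \<dots> = (\<Sum>i\<in>K. \<Sum>j\<in>K. x i * S' i j * x j)"
      unfolding S'_def sum_subtractf[symmetric] by (intro sum.cong refl) (simp add: algebra_simps)
    finally show "0 < (\<Sum>i\<in>K. \<Sum>j\<in>K. x i * S' i j * x j)" .
  qed
  then obtain A where A: "\<And>i j. i \<in> K \<Longrightarrow> j \<in> K \<Longrightarrow> (\<Sum>r\<in>K. A i r * A j r) = S' i j"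
    by blast
  \<comment> \<open>Column \<open>k\<close> contributes the rank-one part that was subtracted in
    \<open>S'\<close>; the remaining entries of row \<open>k\<close> are 0, since that part already
    accounts for all of row \<open>k\<close> of \<open>S\<close>.\<close>
  define A' where "A' i r = (if r = k then S k i / sqrt d else if i = k then 0 else A i r)" for i r
  have k1: "A' i k * A' j k = S k i * S k j / d" for i j
    using d by (simp add: A'_def)
  have "(\<Sum>r\<in>K. A' i r * A' j r) = (if i = k \<or> j = k then 0 else S' i j)"
    if "i \<in> insert k K" "j \<in> insert k K" for i j
  proof -
    have "(\<Sum>r\<in>K. A' i r * A' j r) = (\<Sum>r\<in>K. if i = k \<or> j = k then 0 else A i r * A j r)"
      using insert.hyps(2) by (intro sum.cong) (auto simp: A'_def)
    then show ?thesis using that A by auto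
  qed
  then have "(\<Sum>r\<in>insert k K. A' i r * A' j r) = S i j" if "i \<in> insert k K" "j \<in> insert k K" for i j
    using that insert.hyps insert.prems(1)[of i j] k1[of i j] d
    by (auto simp: S'_def d_def)
  then show ?case by blast
qed

text \<open>In the usual notation this is \<open>P^T P\<close> for the coordinate projection
  \<open>P\<close>; all submatrices then live in the one type of square matrices.\<close>

definition proj_mat :: "'k set \<Rightarrow> real^'k^'k" where
  "proj_mat U = (\<chi> i j. if i = j \<and> i \<in> U then 1 else 0)"

lemma proj_mat_mult: "(proj_mat U ** X) $ i $ j = (if i \<in> U then X $ i $ j else 0)"
  by (cases "i \<in> U")
    (simp_all add: proj_mat_def matrix_matrix_mult_def if_distrib[of "\<lambda>t. t * _"] sum.delta cong: if_cong)

lemma transpose_proj_mat [simp]: "transpose (proj_mat U) = proj_mat U"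
  by (auto simp: proj_mat_def transpose_def vec_eq_iff)

lemma mult_proj_mat: "(X ** proj_mat U) $ i $ j = (if j \<in> U then X $ i $ j else 0)"
proof -
  have "(X ** proj_mat U) $ i $ j = transpose (X ** proj_mat U) $ j $ i" by (simp add: transpose_def)
  then show ?thesis
    unfolding matrix_transpose_mul transpose_proj_mat proj_mat_mult by (simp add: transpose_def)
qed

lemma proj_mat_vec: "(proj_mat U *v x) $ i = (if i \<in> U then x $ i else 0)"
  by (simp add: proj_mat_def matrix_vector_mult_def if_distrib[of "\<lambda>t. t * _"] cong: if_cong)

lemma proj_mat_idem [simp]: "proj_mat U ** proj_mat U = proj_mat U"
  by (simp add: vec_eq_iff proj_mat_mult) (simp add: proj_mat_def)

text \<open>The condition inside \<open>pad_sub_inv\<close> as matrix identities, so that uniqueness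
  and symmetry become associativity arguments.\<close>

definition is_pad_inv :: "real^'k^'k \<Rightarrow> 'k set \<Rightarrow> real^'k^'k \<Rightarrow> bool" where
  "is_pad_inv S U X \<longleftrightarrow> proj_mat U ** X = X \<and> X ** proj_mat U = X \<and> X ** S ** proj_mat U = proj_mat U"

lemma is_pad_inv_iff:
  "is_pad_inv S U M \<longleftrightarrow> (\<forall>i j. (i \<notin> U \<or> j \<notin> U) \<longrightarrow> M $ i $ j = 0) \<and>
       (\<forall>i\<in>U. \<forall>j\<in>U. (\<Sum>l\<in>U. M $ i $ l * S $ l $ j) = (if i = j then 1 else 0))"
  (is "_ \<longleftrightarrow> ?supp \<and> ?inv")
proof -
  have supp: "proj_mat U ** M = M \<and> M ** proj_mat U = M \<longleftrightarrow> ?supp"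
    by (auto simp: vec_eq_iff proj_mat_mult mult_proj_mat)
  have sum_eq: "(\<Sum>l\<in>U. M $ i $ l * S $ l $ j) = (M ** S) $ i $ j" if ?supp for i j
    unfolding matrix_matrix_mult_def using that by (simp add: sum.mono_neutral_left)
  have row0: "(M ** S) $ i $ j = 0" if ?supp "i \<notin> U" for i j
    unfolding matrix_matrix_mult_def using that by simp
  have "M ** S ** proj_mat U = proj_mat U \<longleftrightarrow> ?inv" if ?supp
    using row0[OF that]
    by (simp add: sum_eq[OF that] vec_eq_iff mult_proj_mat) (auto simp: proj_mat_def)
  then show ?thesis unfolding is_pad_inv_def using supp by blast
qed

lemma pad_sub_inv_eq_The: "pad_sub_inv S U = (THE X. is_pad_inv S U X)"
  unfolding pad_sub_inv_def is_pad_inv_iff ..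

text \<open>Positivity is assumed only for vectors supported on \<open>U\<close>. The lemma thus
  serves for \<open>\<Sigma>\<close> and also for the information matrix, which may be singular off
  the observed coordinates.\<close>

lemma pad_inv_exists:
  fixes S :: "real^'k::finite^'k"
  assumes sym: "transpose S = S"
    and pos: "\<And>x. x \<noteq> 0 \<Longrightarrow> proj_mat U *v x = x \<Longrightarrow> 0 < x \<bullet> (S *v x)"
  shows "is_pad_inv S U (pad_sub_inv S U)"
    and "transpose (pad_sub_inv S U) = pad_sub_inv S U"
    and "proj_mat U ** S ** pad_sub_inv S U = proj_mat U"
proof -
  let ?D = "proj_mat U"
  \<comment> \<open>\<open>N\<close> is the principal submatrix on \<open>U\<close> completed by the
    identity elsewhere. A kernel vector has a part on \<open>U\<close> with vanishing quadratic
    form, so this part is 0, and \<open>N\<close> fixes what remains. The padded inverse is the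
    \<open>U\<close> block of the inverse of \<open>N\<close>.\<close>
  define N where "N = ?D ** S ** ?D + (mat 1 - ?D)"
  have DN: "?D ** N = ?D ** S ** ?D" and ND: "N ** ?D = ?D ** S ** ?D"
    unfolding N_def
    by (simp_all add: vec_eq_iff proj_mat_mult mult_proj_mat) (auto simp: mat_def proj_mat_def)
  have "x = 0" if Nx: "N *v x = 0" for x
  proof -
    define y where "y = ?D *v x"
    have Dy: "?D *v y = y" by (simp add: y_def matrix_vector_mul_assoc)
    have "?D *v (S *v y) = (?D ** N) *v x"
      unfolding DN y_def by (simp add: matrix_vector_mul_assoc matrix_mul_assoc)
    also have "\<dots> = 0" using Nx by (simp flip: matrix_vector_mul_assoc)
    finally have Sy: "?D *v (S *v y) = 0" .
    have "y \<bullet> (S *v y) = y \<bullet> (?D *v (S *v y))"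
      by (metis Dy dot_lmul_matrix matrix_vector_mult_def transpose_proj_mat vector_transpose_matrix)
    then have "y = 0" using pos[of y] Dy Sy by fastforce
    then have "N *v x = x"
      unfolding N_def y_def
      by (simp add: matrix_vector_mult_add_rdistrib matrix_vector_mult_diff_rdistrib flip: matrix_vector_mul_assoc)
    then show ?thesis using Nx by simp
  qed
  then obtain Y where YN: "Y ** N = mat 1"
    using matrix_left_invertible_ker[of N] by auto
  then have NY: "N ** Y = mat 1" by (simp add: matrix_left_right_inverse)
  define X where "X = ?D ** Y ** ?D"
  have DX: "?D ** X = X" unfolding X_def by (simp add: matrix_mul_assoc)
  have XD: "X ** ?D = X" unfolding X_def by (simp flip: matrix_mul_assoc)
  have XS: "X ** S ** ?D = ?D"
  proof -
    have "X ** S ** ?D = ?D ** Y ** (?D ** S ** ?D)" unfolding X_def by (simp add: matrix_mul_assoc)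
    also have "\<dots> = ?D ** (Y ** N) ** ?D" unfolding ND[symmetric] by (simp add: matrix_mul_assoc)
    finally show ?thesis by (simp add: YN)
  qed
  have SX: "?D ** S ** X = ?D"
  proof -
    have "?D ** S ** X = (?D ** S ** ?D) ** Y ** ?D" unfolding X_def by (simp add: matrix_mul_assoc)
    also have "\<dots> = ?D ** (N ** Y) ** ?D" unfolding DN[symmetric] by (simp add: matrix_mul_assoc)
    finally show ?thesis by (simp add: NY)
  qed
  have uniq: "Z = X" if "is_pad_inv S U Z" for Z
  proof -
    have Z: "Z ** ?D = Z" "Z ** S ** ?D = ?D" using that by (auto simp: is_pad_inv_def)
    have "Z = Z ** ?D ** S ** X" using SX Z(1) by (metis matrix_mul_assoc)
    also have "\<dots> = (Z ** S ** ?D) ** X" using Z(1) DX by (metis matrix_mul_assoc)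
    finally show ?thesis using Z(2) DX by simp
  qed
  have X: "is_pad_inv S U X" using DX XD XS by (simp add: is_pad_inv_def)
  then have eq: "pad_sub_inv S U = X"
    unfolding pad_sub_inv_eq_The using uniq by blast
  \<comment> \<open>Transposing the right-inverse identity \<open>SX\<close> gives the left-inverse
    identity for \<open>transpose X\<close>; uniqueness then yields symmetry.\<close>
  have "is_pad_inv S U (transpose X)"
  proof -
    have "transpose (?D ** X) = transpose X" "transpose (X ** ?D) = transpose X"
      "transpose (?D ** S ** X) = transpose ?D" using DX XD SX by simp_all
    then show ?thesis
      unfolding matrix_transpose_mul is_pad_inv_def by (simp add: sym matrix_mul_assoc)
  qed
  then have "transpose X = X" by (rule uniq)
  then show "is_pad_inv S U (pad_sub_inv S U)" "transpose (pad_sub_inv S U) = pad_sub_inv S U"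
    "proj_mat U ** S ** pad_sub_inv S U = proj_mat U"
    unfolding eq using X SX by auto
qed

text \<open>Here \<open>F\<close> is invertible on the range of the orthogonal projection
  \<open>D\<close>, with inverse \<open>S\<close>, and zero on its complement. Every Penrose
  candidate \<open>X\<close> has \<open>F ** X = D = X ** F\<close>, which forces
  \<open>X = S\<close>.\<close>

lemma mp_pinv_eqI:
  fixes F :: "real^'k::finite^'k"
  assumes FS: "F ** S = D" and SF: "S ** F = D" and DF: "D ** F = F" and FD: "F ** D = F"
    and DS: "D ** S = S" and SD: "S ** D = S" and D: "transpose D = D"
  shows "mp_pinv F = S"
  unfolding mp_pinv_def
proof (rule the_equality)
  show "F ** S ** F = F \<and> S ** F ** S = S \<and> transpose (F ** S) = F ** S \<and> transpose (S ** F) = S ** F"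
    by (simp add: FS SF DF DS D)
next
  fix X
  assume "F ** X ** F = F \<and> X ** F ** X = X \<and> transpose (F ** X) = F ** X \<and> transpose (X ** F) = X ** F"
  then have X: "F ** X ** F = F" "X ** F ** X = X" "transpose (F ** X) = F ** X" "transpose (X ** F) = X ** F"
    by auto
  \<comment> \<open>Symmetry of \<open>F ** X\<close> moves \<open>D\<close> to the right; replacing
    it there by \<open>F ** S\<close> lets \<open>F ** X ** F\<close> collapse to
    \<open>F\<close>.\<close>
  have "F ** X = transpose (D ** (F ** X))" using X(3) DF by (simp add: matrix_mul_assoc)
  also have "\<dots> = F ** X ** D" by (simp add: matrix_transpose_mul[of D] X(3) D)
  also have "\<dots> = (F ** X ** F) ** S" by (simp add: FS[symmetric] matrix_mul_assoc)
  finally have FX: "F ** X = D" using X(1) FS by simp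
  have "X ** F = transpose (X ** F ** D)" using X(4) FD by (simp flip: matrix_mul_assoc)
  also have "\<dots> = D ** (X ** F)" by (simp add: matrix_transpose_mul[of _ D] X(4) D)
  also have "\<dots> = S ** (F ** X ** F)" by (simp add: SF[symmetric] matrix_mul_assoc)
  finally have XF: "X ** F = D" using X(1) SF by simp
  have "X = D ** X" using X(2) XF by simp
  also have "\<dots> = S ** (F ** X)" by (simp add: SF[symmetric] matrix_mul_assoc)
  finally show "X = S" using FX SD by simp
qed

lemma matrix_vector_mult_sum_left:
  "(\<Sum>i\<in>I. A i) *v x = (\<Sum>i\<in>I. A i *v (x :: real^'k::finite))"
  by (induction I rule: infinite_finite_induct) (auto simp: matrix_vector_mult_add_rdistrib)

lemma transpose_sum: "transpose (\<Sum>i\<in>I. A i) = (\<Sum>i\<in>I. transpose (A i))"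
  by (simp add: transpose_def vec_eq_iff)

section \<open>The information matrix of an allocation\<close>

locale posdef_matrix =
  fixes \<Sigma> :: "real^'k::finite^'k"
  assumes sym: "transpose \<Sigma> = \<Sigma>"
    and posdef: "x \<noteq> 0 \<Longrightarrow> 0 < x \<bullet> (\<Sigma> *v x)"
begin

abbreviation K :: "'k set \<Rightarrow> real^'k^'k" where "K \<equiv> pad_sub_inv \<Sigma>"

lemma transpose_K: "transpose (K I) = K I"
  and K_right_inverse: "proj_mat I ** \<Sigma> ** K I = proj_mat I"
  and K_pad_inv: "is_pad_inv \<Sigma> I (K I)"
  using pad_inv_exists[OF sym, of I] posdef by auto

lemma proj_K: "proj_mat I ** K I = K I"
  using K_pad_inv unfolding is_pad_inv_def by blast

lemma K_supported: "i \<notin> I \<Longrightarrow> (K I *v x) $ i = 0"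
  using proj_mat_vec[of I "K I *v x" i] by (simp add: matrix_vector_mul_assoc proj_K)

text \<open>This is the condition that \<open>minimax_lower_bound\<close> puts on the vectors
  \<open>v\<close>, where only observed coordinates count.\<close>

lemma Sigma_K: "i \<in> I \<Longrightarrow> (\<Sigma> *v (K I *v x)) $ i = x $ i"
  using proj_mat_vec[of I "\<Sigma> *v (K I *v x)" i] proj_mat_vec[of I x i]
  by (simp add: matrix_vector_mul_assoc K_right_inverse matrix_mul_assoc)

text \<open>The vectors \<open>\<Sigma> *v (K I *v x)\<close> and \<open>x\<close> can differ only
  outside \<open>I\<close>, where \<open>K I *v x\<close> vanishes.\<close>

lemma K_quadratic_form: "(K I *v x) \<bullet> (\<Sigma> *v (K I *v x)) = x \<bullet> (K I *v x)"
proof -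
  have "(K I *v x) \<bullet> (\<Sigma> *v (K I *v x)) = (\<Sum>i\<in>UNIV. (K I *v x) $ i * x $ i)"
    unfolding inner_vec_def using Sigma_K[of _ I x] K_supported[of _ I x]
    by (intro sum.cong) (simp_all, metis mult_zero_left)
  then show ?thesis by (simp add: inner_vec_def mult.commute)
qed

lemma K_nonneg: "0 \<le> x \<bullet> (K I *v x)"
  unfolding K_quadratic_form[symmetric]
  using posdef[of "K I *v x"] by (cases "K I *v x = 0") auto

lemma K_pos: "K I *v x \<noteq> 0 \<Longrightarrow> 0 < x \<bullet> (K I *v x)"
  unfolding K_quadratic_form[symmetric] by (rule posdef)

text \<open>The Fisher information for the mean in the Gaussian model with covariance
  \<open>\<Sigma>\<close>; \<open>S_mat\<close> is its pseudo-inverse.\<close>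

definition info :: "'k set set \<Rightarrow> ('k set \<Rightarrow> nat) \<Rightarrow> real^'k^'k" where
  "info \<I> n = (\<Sum>I\<in>\<I>. real (n I) *\<^sub>R K I)"

lemma info_vec: "info \<I> n *v x = (\<Sum>I\<in>\<I>. real (n I) *\<^sub>R (K I *v x))"
  unfolding info_def by (simp add: matrix_vector_mult_sum_left scaleR_matrix_vector_assoc)

lemma info_quadratic_form: "x \<bullet> (info \<I> n *v x) = (\<Sum>I\<in>\<I>. real (n I) * (x \<bullet> (K I *v x)))"
  unfolding info_vec by (simp add: inner_sum_right)

lemma info_pos:
  assumes "I \<in> \<I>" "0 < n I" "K I *v x \<noteq> 0"
  shows "0 < x \<bullet> (info \<I> n *v x)"
  unfolding info_quadratic_form using assms
  by (intro sum_pos2[where i = I]) (auto simp: K_pos K_nonneg)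

text \<open>With \<open>U\<close> the set of observed coordinates, \<open>info\<close> is supported
  on \<open>U\<close> and positive definite there. Its pseudo-inverse is therefore the padded
  inverse on \<open>U\<close>, the product of the two is the projection onto \<open>U\<close>, and
  coverage says that this projection fixes \<open>a\<close>.\<close>

lemma info_S_mat:
  assumes cov: "covers_supp \<I> a n"
  shows "info \<I> n *v (S_mat \<I> \<Sigma> n *v a) = a"
proof -
  define U where "U = \<Union>{I\<in>\<I>. 0 < n I}"
  let ?F = "info \<I> n" and ?D = "proj_mat U"
  have symF: "transpose ?F = ?F"
    unfolding info_def transpose_sum by (simp add: transpose_scalar transpose_K)
  have DF: "?D ** ?F = ?F"
  proof -
    have "?F $ i $ j = 0" if "i \<notin> U" for i j
    proof -
      have "real (n I) * K I $ i $ j = 0" if "I \<in> \<I>" for I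
      proof (cases "0 < n I")
        case True
        then have "i \<notin> I" using \<open>i \<notin> U\<close> \<open>I \<in> \<I>\<close> by (auto simp: U_def)
        then show ?thesis using proj_mat_mult[of I "K I" i j] by (simp add: proj_K)
      qed simp
      then have "(\<Sum>I\<in>\<I>. real (n I) * K I $ i $ j) = 0" by (intro sum.neutral ballI)
      then show ?thesis by (simp add: info_def)
    qed
    then show ?thesis by (auto simp: vec_eq_iff proj_mat_mult)
  qed
  have FD: "?F ** ?D = ?F"
    using matrix_transpose_mul[of ?D ?F] symF DF by simp
  have pos: "0 < x \<bullet> (?F *v x)" if x: "x \<noteq> 0" "?D *v x = x" for x
  proof -
    obtain i where i: "x $ i \<noteq> 0" using x(1) by (auto simp: vec_eq_iff)
    then have "i \<in> U" using x(2) proj_mat_vec[of U x i] by metis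
    then obtain I where I: "I \<in> \<I>" "0 < n I" "i \<in> I" by (auto simp: U_def)
    have "K I *v x \<noteq> 0"
      using Sigma_K[OF I(3), of x] i by auto
    then show ?thesis using I info_pos by blast
  qed
  let ?S = "pad_sub_inv ?F U"
  note S = pad_inv_exists[OF symF, of U, OF pos]
  have S': "?D ** ?S = ?S" "?S ** ?D = ?S" "?S ** ?F = ?D"
    using S(1) FD unfolding is_pad_inv_def by (simp_all flip: matrix_mul_assoc)
  have FS: "?F ** ?S = ?D" using S(3) DF by simp
  have "S_mat \<I> \<Sigma> n = ?S"
    unfolding S_mat_def info_def[symmetric]
    by (rule mp_pinv_eqI[of _ _ ?D]) (simp_all add: S' FS DF FD)
  moreover have "?D *v a = a"
  proof -
    have "a $ i = 0" if "i \<notin> U" for i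
      using cov that unfolding covers_supp_def U_def by blast
    then show ?thesis by (simp add: vec_eq_iff proj_mat_vec)
  qed
  ultimately show ?thesis by (simp add: matrix_vector_mul_assoc FS)
qed

end

section \<open>Moments of the estimator\<close>

lemma measurable_vec_nth [measurable]: "(\<lambda>x::real^'k::finite. x $ i) \<in> borel_measurable borel"
  by (intro borel_measurable_continuous_onI continuous_on_component continuous_on_id)

lemma measurable_vec_lambda:
  fixes f :: "'k::finite \<Rightarrow> 'a \<Rightarrow> real"
  assumes "\<And>i. f i \<in> borel_measurable M"
  shows "(\<lambda>x. \<chi> i. f i x) \<in> borel_measurable M"
proof -
  have "(\<lambda>x. (\<chi> i. f i x) \<bullet> b) \<in> borel_measurable M" if "b \<in> Basis" for b
    using that assms unfolding Basis_vec_def by (force simp: inner_axis)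
  then show ?thesis by (subst borel_measurable_euclidean_space) blast
qed

lemma (in prob_space) centered_sum:
  fixes g :: "'i \<Rightarrow> 'a \<Rightarrow> real"
  assumes "\<And>i. i \<in> I \<Longrightarrow> integrable M (g i)" "\<And>i. i \<in> I \<Longrightarrow> expectation (g i) = 0"
  shows "has_bochner_integral (PiM I (\<lambda>_. M)) (\<lambda>\<omega>. \<Sum>i\<in>I. g i (\<omega> i)) 0"
proof -
  have "has_bochner_integral (PiM I (\<lambda>_. M)) (\<lambda>\<omega>. g i (\<omega> i)) 0" if i: "i \<in> I" for i
  proof -
    have "distr (PiM I (\<lambda>_. M)) M (\<lambda>\<omega>. \<omega> i) = M"
      using i by (intro distr_PiM_component prob_space_axioms)
    then show ?thesis
      using assms i integrable_distr_eq[of "\<lambda>\<omega>. \<omega> i" "PiM I (\<lambda>_. M)" M "g i"]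
        integral_distr[of "\<lambda>\<omega>. \<omega> i" "PiM I (\<lambda>_. M)" M "g i"]
      by (simp add: has_bochner_integral_iff borel_measurable_integrable)
  qed
  then have "has_bochner_integral (PiM I (\<lambda>_. M)) (\<lambda>\<omega>. \<Sum>i\<in>I. g i (\<omega> i)) (\<Sum>i\<in>I. 0)"
    by (rule has_bochner_integral_sum)
  then show ?thesis by simp
qed

lemma copies_Sigma: "copies \<I> n = (SIGMA I:\<I>. {..<n I})"
  by (auto simp: copies_def)

lemma finite_copies [simp]: "finite (copies \<I> (n :: 'k::finite set \<Rightarrow> nat))"
  by (simp add: copies_Sigma)

lemma sum_copies:
  fixes F :: "'k::finite set \<Rightarrow> nat \<Rightarrow> real"
  shows "(\<Sum>(I, j)\<in>copies \<I> n. F I j) = (\<Sum>I\<in>{I\<in>\<I>. 0 < n I}. \<Sum>j<n I. F I j)"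
proof -
  have "(\<Sum>(I, j)\<in>copies \<I> n. F I j) = (\<Sum>I\<in>\<I>. \<Sum>j<n I. F I j)"
    unfolding copies_Sigma by (simp add: sum.Sigma)
  also have "\<dots> = (\<Sum>I\<in>{I\<in>\<I>. 0 < n I}. \<Sum>j<n I. F I j)"
    by (rule sum.mono_neutral_right) auto
  finally show ?thesis .
qed

lemma dists_covD:
  fixes P :: "(real^'k::finite) measure"
  assumes "P \<in> dists_cov \<Sigma>"
  shows "prob_space P" "sets P = sets borel"
    and "has_bochner_integral P (\<lambda>x. x $ i - mean_vec P $ i) 0"
    and "has_bochner_integral P (\<lambda>x. (x $ i - mean_vec P $ i) * (x $ j - mean_vec P $ j)) (\<Sigma> $ i $ j)"
proof -
  show P: "prob_space P" and S: "sets P = sets borel" using assms by (auto simp: dists_cov_def)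
  interpret prob_space P by (rule P)
  note [measurable_cong] = S
  have [measurable]: "(\<lambda>x. x $ i) \<in> borel_measurable P" for i by measurable
  have sq: "integrable P (\<lambda>x. (x $ i)\<^sup>2)" for i using assms by (simp add: dists_cov_def)
  have int: "integrable P (\<lambda>x. x $ i)" for i
    by (rule square_integrable_imp_integrable[OF _ sq]) measurable
  show "has_bochner_integral P (\<lambda>x. x $ i - mean_vec P $ i) 0"
    using int by (simp add: has_bochner_integral_iff mean_vec_def prob_space)
  have "integrable P (\<lambda>x. (x $ i - mean_vec P $ i)\<^sup>2)" for i
    using int sq by (simp add: power2_diff)
  then have "integrable P (\<lambda>x. (x $ i - mean_vec P $ i) * (x $ j - mean_vec P $ j))"
    by (intro integrable_mult_of_squares) auto
  then show "has_bochner_integral P (\<lambda>x. (x $ i - mean_vec P $ i) * (x $ j - mean_vec P $ j)) (\<Sigma> $ i $ j)"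
    using assms by (simp add: has_bochner_integral_iff dists_cov_def)
qed

text \<open>Minus its mean \<open>m\<close>, the estimator is a sum of independent centred terms
  \<open>Y c\<close>, one per copy. Their second moments add up and depend on \<open>P\<close> only
  through \<open>\<Sigma>\<close>.\<close>

lemma theta_hat_moments:
  fixes P :: "(real^'k::finite) measure" and n :: "'k set \<Rightarrow> nat" and \<I> :: "'k set set" and lam
  assumes P: "P \<in> dists_cov \<Sigma>"
  defines "m \<equiv> (\<Sum>I\<in>{I\<in>\<I>. 0 < n I}. \<Sum>i\<in>I. lam I $ i * mean_vec P $ i)"
  shows "has_bochner_integral (copies_law \<I> n P) (theta_hat \<I> n lam) m"
    and "has_bochner_integral (copies_law \<I> n P) (\<lambda>\<omega>. (theta_hat \<I> n lam \<omega> - m)\<^sup>2) (ppi_obj \<I> \<Sigma> n lam)"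
proof -
  note D = dists_covD[OF P]
  interpret prob_space P by (rule D(1))
  interpret C: prob_space "copies_law \<I> n P"
    unfolding copies_law_def by (intro prob_space_PiM D(1))
  define Y :: "'k set \<times> nat \<Rightarrow> real^'k \<Rightarrow> real"
    where "Y c x = (1 / real (n (fst c))) * (\<Sum>i\<in>fst c. lam (fst c) $ i * (x $ i - mean_vec P $ i))" for c x
  have Y1: "has_bochner_integral P (Y c) 0" for c
  proof -
    have "has_bochner_integral P (Y c) ((1 / real (n (fst c))) * (\<Sum>i\<in>fst c. lam (fst c) $ i * 0))"
      unfolding Y_def by (intro has_bochner_integral_mult_right has_bochner_integral_sum D(3))
    then show ?thesis by simp
  qed
  have Y2: "has_bochner_integral P (\<lambda>x. Y (I, j) x * Y (I, j) x)
      ((1 / real (n I))\<^sup>2 * (\<Sum>i\<in>I. \<Sum>l\<in>I. lam I $ i * \<Sigma> $ i $ l * lam I $ l))" for I j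
  proof -
    have "has_bochner_integral P (\<lambda>x. (1 / real (n I))\<^sup>2 * (\<Sum>i\<in>I. \<Sum>l\<in>I. lam I $ i *
        ((x $ i - mean_vec P $ i) * (x $ l - mean_vec P $ l)) * lam I $ l))
      ((1 / real (n I))\<^sup>2 * (\<Sum>i\<in>I. \<Sum>l\<in>I. lam I $ i * \<Sigma> $ i $ l * lam I $ l))"
      by (intro has_bochner_integral_mult_right has_bochner_integral_mult_left has_bochner_integral_sum D(4))
    moreover have "Y (I, j) x * Y (I, j) x = (1 / real (n I))\<^sup>2 * (\<Sum>i\<in>I. \<Sum>l\<in>I. lam I $ i *
        ((x $ i - mean_vec P $ i) * (x $ l - mean_vec P $ l)) * lam I $ l)" for x
    proof -
      have "Y (I, j) x * Y (I, j) x = (1 / real (n I))\<^sup>2 *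
          ((\<Sum>i\<in>I. lam I $ i * (x $ i - mean_vec P $ i)) * (\<Sum>l\<in>I. lam I $ l * (x $ l - mean_vec P $ l)))"
        by (simp add: Y_def power2_eq_square)
      also have "(\<Sum>i\<in>I. lam I $ i * (x $ i - mean_vec P $ i)) * (\<Sum>l\<in>I. lam I $ l * (x $ l - mean_vec P $ l))
          = (\<Sum>i\<in>I. \<Sum>l\<in>I. lam I $ i * ((x $ i - mean_vec P $ i) * (x $ l - mean_vec P $ l)) * lam I $ l)"
        unfolding sum_product by (intro sum.cong refl) (simp only: mult_ac)
      finally show ?thesis .
    qed
    ultimately show ?thesis by simp
  qed
  have theta: "theta_hat \<I> n lam \<omega> - m = (\<Sum>c\<in>copies \<I> n. Y c (\<omega> c))" for \<omega>
  proof -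
    have "(\<Sum>c\<in>copies \<I> n. Y c (\<omega> c)) = (\<Sum>(I, j)\<in>copies \<I> n. Y (I, j) (\<omega> (I, j)))"
      by (intro sum.cong) auto
    also have "\<dots> = (\<Sum>I\<in>{I\<in>\<I>. 0 < n I}. \<Sum>j<n I. Y (I, j) (\<omega> (I, j)))"
      by (rule sum_copies)
    also have "\<dots> = (\<Sum>I\<in>{I\<in>\<I>. 0 < n I}. (1 / real (n I)) * (\<Sum>j<n I. \<Sum>i\<in>I. lam I $ i * \<omega> (I, j) $ i)
        - (\<Sum>i\<in>I. lam I $ i * mean_vec P $ i))"
      by (intro sum.cong refl)
        (simp add: Y_def right_diff_distrib sum_subtractf sum_distrib_left[symmetric] sum_divide_distrib[symmetric])
    finally show ?thesis by (simp add: theta_hat_def m_def sum_subtractf)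
  qed
  have "has_bochner_integral (copies_law \<I> n P) (\<lambda>\<omega>. \<Sum>c\<in>copies \<I> n. Y c (\<omega> c)) 0"
    unfolding copies_law_def using Y1 by (intro centered_sum) (auto simp: has_bochner_integral_iff)
  then have "has_bochner_integral (copies_law \<I> n P) (\<lambda>\<omega>. (theta_hat \<I> n lam \<omega> - m) + m) (0 + m)"
    unfolding theta by (intro has_bochner_integral_add)
      (simp_all add: has_bochner_integral_iff C.prob_space)
  then show "has_bochner_integral (copies_law \<I> n P) (theta_hat \<I> n lam) m" by simp
  have "(\<Sum>c\<in>copies \<I> n. expectation (\<lambda>x. Y c x * Y c x))
      = (\<Sum>(I, j)\<in>copies \<I> n. expectation (\<lambda>x. Y (I, j) x * Y (I, j) x))"
    by (intro sum.cong) auto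
  also have "\<dots> = ppi_obj \<I> \<Sigma> n lam"
    unfolding sum_copies has_bochner_integral_integral_eq[OF Y2] ppi_obj_def
    by (intro sum.cong refl) (simp add: power2_eq_square)
  finally have val: "(\<Sum>c\<in>copies \<I> n. expectation (\<lambda>x. Y c x * Y c x)) = ppi_obj \<I> \<Sigma> n lam" .
  have "integrable P (\<lambda>x. Y c x * Y c x)" for c
    using Y2[of "fst c" "snd c"] by (simp add: has_bochner_integral_iff)
  then show "has_bochner_integral (copies_law \<I> n P) (\<lambda>\<omega>. (theta_hat \<I> n lam \<omega> - m)\<^sup>2) (ppi_obj \<I> \<Sigma> n lam)"
    using centered_sum_products[OF finite_copies, of \<I> n Y Y] Y1
    unfolding theta copies_law_def power2_eq_square val
    by (simp add: has_bochner_integral_iff)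
qed

lemma theta_hat_variance:
  fixes P :: "(real^'k::finite) measure"
  assumes "P \<in> dists_cov \<Sigma>"
  shows "prob_space.variance (copies_law \<I> n P) (theta_hat \<I> n lam) = ppi_obj \<I> \<Sigma> n lam"
  using theta_hat_moments[OF assms, of \<I> n lam] by (simp add: has_bochner_integral_iff)

text \<open>The estimator \<open>theta_hat\<close> as a function of the observed coordinates alone,
  which is the form that \<open>budget_estimators\<close> asks for.\<close>

definition theta_est :: "'k set set \<Rightarrow> ('k set \<Rightarrow> nat) \<Rightarrow> ('k set \<Rightarrow> real^'k::finite) \<Rightarrow> ('k set \<times> nat \<times> 'k \<Rightarrow> real) \<Rightarrow> real" where
  "theta_est \<I> n lam y = (\<Sum>I\<in>{I\<in>\<I>. 0 < n I}. (1 / real (n I)) *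
       (\<Sum>j<n I. \<Sum>i\<in>I. lam I $ i * y (I, j, i)))"

lemma theta_est_observe: "theta_est \<I> n lam (observe \<I> n \<omega>) = theta_hat \<I> n lam \<omega>"
  unfolding theta_est_def theta_hat_def
  by (intro sum.cong refl arg_cong2[where f = "(*)"]) (auto simp: observe_def obs_idx_def)

lemma theta_est_measurable: "theta_est \<I> n lam \<in> borel_measurable (PiM (obs_idx \<I> n) (\<lambda>_. borel))"
proof -
  have "(\<lambda>y. y (I, j, i)) \<in> borel_measurable (PiM (obs_idx \<I> n) (\<lambda>_. borel :: real measure))"
    if "I \<in> \<I>" "j < n I" "i \<in> I" for I j i
    using that by (intro measurable_component_singleton) (auto simp: obs_idx_def)
  then show ?thesis
    unfolding theta_est_def
    by (intro borel_measurable_sum borel_measurable_times borel_measurable_const) auto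
qed

text \<open>Unbiasedness identifies the mean \<open>m\<close> with the target, so the risk is the
  variance and does not vary over \<open>dists_cov \<Sigma>\<close>.\<close>

lemma mse_theta_est:
  fixes P :: "(real^'k::finite) measure"
  assumes P: "P \<in> dists_cov \<Sigma>" and w: "weights_ok \<I> lam" and u: "unbiased_ok \<I> a n lam"
  shows "mse \<I> a n (theta_est \<I> n lam) P = ennreal (ppi_obj \<I> \<Sigma> n lam)"
proof -
  have "(\<Sum>I\<in>{I\<in>\<I>. 0 < n I}. \<Sum>i\<in>I. lam I $ i * mean_vec P $ i) = (\<Sum>I\<in>{I\<in>\<I>. 0 < n I}. lam I \<bullet> mean_vec P)"
  proof (rule sum.cong[OF refl])
    fix I assume I: "I \<in> {I\<in>\<I>. 0 < n I}"
    have "(\<Sum>i\<in>I. lam I $ i * mean_vec P $ i) = (\<Sum>i\<in>UNIV. lam I $ i * mean_vec P $ i)"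
      using I w by (intro sum.mono_neutral_left) (simp_all add: weights_ok_def)
    then show "(\<Sum>i\<in>I. lam I $ i * mean_vec P $ i) = lam I \<bullet> mean_vec P"
      by (simp add: inner_vec_def)
  qed
  also have "\<dots> = a \<bullet> mean_vec P"
    using u by (simp add: unbiased_ok_def inner_sum_left[symmetric])
  finally have m: "(\<Sum>I\<in>{I\<in>\<I>. 0 < n I}. \<Sum>i\<in>I. lam I $ i * mean_vec P $ i) = a \<bullet> mean_vec P" .
  show ?thesis
    using theta_hat_moments(2)[OF P, of \<I> n lam]
    unfolding mse_def theta_est_observe m
    by (simp add: has_bochner_integral_iff nn_integral_eq_integral)
qed

section \<open>The minimax lower bound\<close>

lemma observe_measurable:
  "observe \<I> n \<in> measurable (PiM (copies \<I> n) (\<lambda>_. borel :: (real^'k::finite) measure)) (PiM (obs_idx \<I> n) (\<lambda>_. borel))"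
  unfolding observe_def
proof (rule measurable_restrict)
  fix c assume "c \<in> obs_idx \<I> n"
  then obtain I j i where c: "c = (I, j, i)" "(I, j) \<in> copies \<I> n" by (auto simp: obs_idx_def copies_def)
  have "(\<lambda>\<omega>. \<omega> (I, j)) \<in> measurable (PiM (copies \<I> n) (\<lambda>_. borel :: (real^'k) measure)) borel"
    using c(2) by (rule measurable_component_singleton)
  then show "(\<lambda>\<omega>. case c of (I, j, i) \<Rightarrow> \<omega> (I, j) $ i)
      \<in> borel_measurable (PiM (copies \<I> n) (\<lambda>_. borel :: (real^'k) measure))"
    unfolding c by (simp add: measurable_compose[OF _ measurable_vec_nth])
qed

lemma observe_cong:
  assumes "\<And>I j i. (I, j) \<in> copies \<I> n \<Longrightarrow> i \<in> I \<Longrightarrow> \<omega> (I, j) $ i = \<omega>' (I, j) $ i"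
  shows "observe \<I> n \<omega> = observe \<I> n \<omega>'"
  unfolding observe_def using assms by (auto simp: obs_idx_def copies_def fun_eq_iff restrict_def)

section \<open>Gaussian laws with given mean and covariance\<close>

lemma prob_space_std_normal: "prob_space std_normal"
  by (rule prob_space_normal_density) simp

lemma std_normal_moments:
  "has_bochner_integral std_normal (\<lambda>x. x) 0" "has_bochner_integral std_normal (\<lambda>x. x * x) 1"
  using std_normal_moment_odd[of 0] std_normal_moment_even[of 1]
  by (auto simp: has_bochner_integral_iff integrable_density integral_density power2_eq_square)

definition gauss :: "('k::finite \<Rightarrow> real) measure" where
  "gauss = PiM UNIV (\<lambda>_. std_normal)"

definition gauss_affine :: "('k::finite \<Rightarrow> 'k \<Rightarrow> real) \<Rightarrow> real^'k \<Rightarrow> ('k \<Rightarrow> real) \<Rightarrow> real^'k" where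
  "gauss_affine A m z = (\<chi> i. (\<Sum>r\<in>UNIV. A i r * z r) + m $ i)"

lemma prob_space_gauss: "prob_space gauss"
  unfolding gauss_def by (intro prob_space_PiM prob_space_std_normal)

lemma gauss_component_measurable: "(\<lambda>z. z r) \<in> borel_measurable gauss"
proof -
  have "(\<lambda>z. z r) \<in> measurable (PiM UNIV (\<lambda>_. std_normal)) std_normal"
    by (rule measurable_component_singleton) simp
  then show ?thesis by (simp add: gauss_def)
qed

lemma gauss_affine_measurable: "gauss_affine A m \<in> borel_measurable gauss"
  unfolding gauss_affine_def
  by (intro measurable_vec_lambda borel_measurable_add borel_measurable_sum borel_measurable_times
      borel_measurable_const gauss_component_measurable)

text \<open>Centred sums of independent coordinates have covariance \<open>A A^T\<close>. Hence the
  Gaussian shift family lies in \<open>dists_cov \<Sigma>\<close>, and its risks are bounded by the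
  supremum over that class.\<close>

lemma gauss_affine_law:
  fixes A :: "'k::finite \<Rightarrow> 'k \<Rightarrow> real" and m :: "real^'k"
  assumes A: "\<And>i j. (\<Sum>r\<in>UNIV. A i r * A j r) = \<Sigma> $ i $ j"
  defines "P \<equiv> distr gauss borel (gauss_affine A m)"
  shows "mean_vec P = m" and "P \<in> dists_cov \<Sigma>"
proof -
  interpret N: prob_space std_normal by (rule prob_space_std_normal)
  interpret G: prob_space gauss by (rule prob_space_gauss)
  note meas = gauss_affine_measurable[of A m]
  define L where "L i z = (\<Sum>r\<in>UNIV. A i r * z r)" for i and z :: "'k \<Rightarrow> real"
  have X: "gauss_affine A m z $ i = L i z + m $ i" for z i by (simp add: gauss_affine_def L_def)
  have lin: "has_bochner_integral std_normal (\<lambda>x. A i r * x) 0" for i r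
    using has_bochner_integral_mult_right[OF std_normal_moments(1), of "A i r"] by simp
  have quad: "has_bochner_integral std_normal (\<lambda>x. (A i r * x) * (A j r * x)) (A i r * A j r)" for i j r
    using has_bochner_integral_mult_right[OF std_normal_moments(2), of "A i r * A j r"] by (simp add: ac_simps)
  have L1: "has_bochner_integral gauss (L i) 0" for i
    unfolding L_def gauss_def using lin by (intro N.centered_sum) (auto simp: has_bochner_integral_iff)
  have L2: "has_bochner_integral gauss (\<lambda>z. L i z * L j z) (\<Sigma> $ i $ j)" for i j
    using N.centered_sum_products[of UNIV "\<lambda>r x. A i r * x" "\<lambda>r x. A j r * x"] lin quad[of i _ j]
    unfolding L_def gauss_def by (simp add: has_bochner_integral_iff A)
  have "has_bochner_integral gauss (\<lambda>z. gauss_affine A m z $ i) (0 + m $ i)" for i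
    unfolding X by (intro has_bochner_integral_add L1) (simp add: has_bochner_integral_iff G.prob_space)
  then have mean: "mean_vec P $ i = m $ i" for i
    unfolding P_def mean_vec_def
    by (simp add: integral_distr[OF meas] has_bochner_integral_iff)
  then show "mean_vec P = m" by (simp add: vec_eq_iff)
  have "integrable gauss (\<lambda>z. (gauss_affine A m z $ i)\<^sup>2)" for i
  proof -
    have "integrable gauss (\<lambda>z. L i z * L i z + L i z * (2 * m $ i) + (m $ i)\<^sup>2)"
      using L1 L2 by (simp add: has_bochner_integral_iff)
    then show ?thesis unfolding X by (simp add: power2_eq_square algebra_simps)
  qed
  then have "integrable P (\<lambda>x. (x $ i)\<^sup>2)" for i
    unfolding P_def by (subst integrable_distr_eq[OF meas]) auto
  moreover have "(\<integral>x. (x $ i - mean_vec P $ i) * (x $ j - mean_vec P $ j) \<partial>P) = \<Sigma> $ i $ j" for i j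
  proof -
    have "(\<integral>x. (x $ i - m $ i) * (x $ j - m $ j) \<partial>P) = (\<integral>z. L i z * L j z \<partial>gauss)"
      unfolding P_def by (subst integral_distr[OF meas]) (auto simp: X)
    then show ?thesis using L2 by (simp add: mean has_bochner_integral_iff)
  qed
  ultimately show "P \<in> dists_cov \<Sigma>"
    unfolding dists_cov_def using G.prob_space_distr[OF meas] by (auto simp: P_def)
qed

lemma gauss_shift_measurable: "(\<lambda>z. \<lambda>r\<in>UNIV. z r + h r) \<in> measurable gauss gauss"
proof -
  have "(\<lambda>z. z r + h r) \<in> borel_measurable gauss" for r
    by (intro borel_measurable_add borel_measurable_const gauss_component_measurable)
  then have "(\<lambda>z. \<lambda>r\<in>UNIV. z r + h r) \<in> measurable gauss (PiM UNIV (\<lambda>_. std_normal))"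
    by (intro measurable_restrict) simp
  then show ?thesis by (simp add: gauss_def)
qed

lemma distr_gauss_shift:
  "distr gauss gauss (\<lambda>z. \<lambda>r\<in>UNIV. z r + h r)
    = density gauss (\<lambda>z. ennreal (exp (\<Sum>r\<in>UNIV. h r * z r - (h r)\<^sup>2 / 2)))"
proof -
  have "distr gauss gauss (\<lambda>z. \<lambda>r\<in>UNIV. z r + h r)
      = density gauss (\<lambda>z. \<Prod>r\<in>UNIV. ennreal (exp (h r * z r - (h r)\<^sup>2 / 2)))"
    unfolding gauss_def
    by (rule distr_PiM_eq_density[where s = "\<lambda>r x. x + h r" and L = "\<lambda>r x. ennreal (exp (h r * x - (h r)\<^sup>2 / 2))"])
      (simp_all add: prob_space_std_normal distr_std_normal_shift)
  then show ?thesis by (simp add: prod_ennreal exp_sum)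
qed

lemma (in posdef_matrix) factor_Sigma:
  "\<exists>A :: 'k \<Rightarrow> 'k \<Rightarrow> real. \<forall>i j. (\<Sum>r\<in>UNIV. A i r * A j r) = \<Sigma> $ i $ j"
proof -
  have "\<exists>A :: 'k \<Rightarrow> 'k \<Rightarrow> real. \<forall>i\<in>UNIV. \<forall>j\<in>UNIV. (\<Sum>r\<in>UNIV. A i r * A j r) = \<Sigma> $ i $ j"
  proof (rule cholesky)
    show "\<Sigma> $ i $ j = \<Sigma> $ j $ i" for i j
      using sym unfolding transpose_def by (metis vec_lambda_beta)
    fix x :: "'k \<Rightarrow> real"
    assume "\<exists>i\<in>UNIV. x i \<noteq> 0"
    then have "(\<chi> i. x i) \<noteq> 0" by (auto simp: vec_eq_iff)
    from posdef[OF this] show "0 < (\<Sum>i\<in>UNIV. \<Sum>j\<in>UNIV. x i * \<Sigma> $ i $ j * x j)"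
      by (simp add: inner_vec_def matrix_vector_mult_def sum_distrib_left mult.assoc)
  qed simp
  then show ?thesis by simp
qed

text \<open>By \<open>au\<close> the target at mean \<open>t *\<^sub>R u\<close> is
  \<open>t\<close>. The vectors \<open>v\<close> are left free for two uses: \<open>K I *v u\<close>
  makes the sum equal to the information in direction \<open>u\<close>, while 0 is admissible when
  \<open>u\<close> vanishes on all observed coordinates.\<close>

lemma (in posdef_matrix) minimax_lower_bound:
  fixes n :: "'k set \<Rightarrow> nat" and u a :: "real^'k" and v :: "'k set \<Rightarrow> real^'k"
  assumes f: "f \<in> borel_measurable (PiM (obs_idx \<I> n) (\<lambda>_. borel))"
    and au: "a \<bullet> u = 1"
    and v: "\<And>I i. I \<in> \<I> \<Longrightarrow> 0 < n I \<Longrightarrow> i \<in> I \<Longrightarrow> (\<Sigma> *v v I) $ i = u $ i"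
    and \<epsilon>: "0 < \<epsilon>"
  shows "ennreal (1 / ((\<Sum>I\<in>\<I>. real (n I) * (v I \<bullet> (\<Sigma> *v v I))) + \<epsilon>)) \<le> (SUP P\<in>dists_cov \<Sigma>. mse \<I> a n f P)"
proof -
  obtain A :: "'k \<Rightarrow> 'k \<Rightarrow> real" where A: "\<And>i j. (\<Sum>r\<in>UNIV. A i r * A j r) = \<Sigma> $ i $ j"
    using factor_Sigma by blast
  let ?C = "copies \<I> n"
  define \<Gamma> where "\<Gamma> = PiM ?C (\<lambda>_. gauss :: ('k \<Rightarrow> real) measure)"
  define h where "h c r = (\<Sum>i\<in>UNIV. A i r * v (fst c) $ i)" for c :: "'k set \<times> nat" and r
  \<comment> \<open>\<open>T\<close> and \<open>J\<close> are the linear statistic and the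
    information in the log likelihood ratio of the noise shift by \<open>t * h c r\<close>.\<close>
  define T where "T \<omega> = (\<Sum>c\<in>?C. \<Sum>r\<in>UNIV. h c r * \<omega> c r)" for \<omega> :: "'k set \<times> nat \<Rightarrow> 'k \<Rightarrow> real"
  define J where "J = (\<Sum>I\<in>\<I>. real (n I) * (v I \<bullet> (\<Sigma> *v v I)))"
  \<comment> \<open>The data for all means are realised on the one noise space
    \<open>\<Gamma>\<close>. Passing from mean 0 to \<open>t *\<^sub>R u\<close> then amounts to
    composing with the noise shift \<open>s t\<close>.\<close>
  define obs where "obs m \<omega> = observe \<I> n (\<lambda>c\<in>?C. gauss_affine A m (\<omega> c))"
    for m and \<omega> :: "'k set \<times> nat \<Rightarrow> 'k \<Rightarrow> real"
  define g where "g \<omega> = f (obs 0 \<omega>)" for \<omega>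
  define s where "s t \<omega> = (\<lambda>c\<in>?C. \<lambda>r\<in>UNIV. \<omega> c r + t * h c r)"
    for t and \<omega> :: "'k set \<times> nat \<Rightarrow> 'k \<Rightarrow> real"
  interpret \<Gamma>: prob_space \<Gamma>
    unfolding \<Gamma>_def by (intro prob_space_PiM prob_space_gauss)
  have comp: "(\<lambda>\<omega>. \<omega> c) \<in> measurable \<Gamma> gauss" if "c \<in> ?C" for c
    unfolding \<Gamma>_def using that by (rule measurable_component_singleton)
  have affine_meas: "(\<lambda>\<omega>. \<lambda>c\<in>?C. gauss_affine A m (\<omega> c)) \<in> measurable \<Gamma> (PiM ?C (\<lambda>_. borel))" for m
    by (intro measurable_restrict measurable_compose[OF comp gauss_affine_measurable])
  have obs_meas: "(\<lambda>\<omega>. f (obs m \<omega>)) \<in> borel_measurable \<Gamma>" for m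
    unfolding obs_def by (intro measurable_compose[OF measurable_compose[OF affine_meas observe_measurable] f])
  have T_meas: "T \<in> borel_measurable \<Gamma>"
    unfolding T_def
    by (intro borel_measurable_sum borel_measurable_times borel_measurable_const
        measurable_compose[OF comp gauss_component_measurable])

  have h_sq: "(\<Sum>r\<in>UNIV. (h c r)\<^sup>2) = v (fst c) \<bullet> (\<Sigma> *v v (fst c))" for c
  proof -
    have "(\<Sum>r\<in>UNIV. (h c r)\<^sup>2) = (\<Sum>r\<in>UNIV. \<Sum>i\<in>UNIV. \<Sum>j\<in>UNIV. v (fst c) $ i * (A i r * A j r) * v (fst c) $ j)"
      unfolding h_def power2_eq_square sum_product by (intro sum.cong refl) simp
    also have "\<dots> = (\<Sum>i\<in>UNIV. \<Sum>r\<in>UNIV. \<Sum>j\<in>UNIV. v (fst c) $ i * (A i r * A j r) * v (fst c) $ j)"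
      by (rule sum.swap)
    also have "\<dots> = (\<Sum>i\<in>UNIV. \<Sum>j\<in>UNIV. \<Sum>r\<in>UNIV. v (fst c) $ i * (A i r * A j r) * v (fst c) $ j)"
      by (intro sum.cong refl sum.swap)
    also have "\<dots> = (\<Sum>i\<in>UNIV. \<Sum>j\<in>UNIV. v (fst c) $ i * \<Sigma> $ i $ j * v (fst c) $ j)"
      by (simp only: A sum_distrib_left[symmetric] sum_distrib_right[symmetric])
    finally show ?thesis
      by (simp add: inner_vec_def matrix_vector_mult_def sum_distrib_left mult.assoc)
  qed
  have J_eq: "(\<Sum>c\<in>?C. \<Sum>r\<in>UNIV. (h c r)\<^sup>2) = J"
  proof -
    have "(\<Sum>c\<in>?C. \<Sum>r\<in>UNIV. (h c r)\<^sup>2) = (\<Sum>(I, j)\<in>?C. v I \<bullet> (\<Sigma> *v v I))"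
      by (intro sum.cong) (auto simp: h_sq)
    also have "\<dots> = (\<Sum>I\<in>{I\<in>\<I>. 0 < n I}. \<Sum>j<n I. v I \<bullet> (\<Sigma> *v v I))"
      by (rule sum_copies)
    also have "\<dots> = J"
      unfolding J_def by (simp, rule sum.mono_neutral_left) auto
    finally show ?thesis .
  qed
  have J_nonneg: "0 \<le> J" unfolding J_eq[symmetric] by (intro sum_nonneg) auto
  have h_shift: "(\<Sum>r\<in>UNIV. A i r * h c r) = (\<Sigma> *v v (fst c)) $ i" for c i
  proof -
    have "(\<Sum>r\<in>UNIV. A i r * h c r) = (\<Sum>r\<in>UNIV. \<Sum>j\<in>UNIV. (A i r * A j r) * v (fst c) $ j)"
      unfolding h_def sum_distrib_left by (intro sum.cong refl) simp
    also have "\<dots> = (\<Sum>j\<in>UNIV. \<Sum>r\<in>UNIV. (A i r * A j r) * v (fst c) $ j)" by (rule sum.swap)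
    finally show ?thesis by (simp add: A sum_distrib_right[symmetric] matrix_vector_mult_def)
  qed
  text \<open>Only the coordinates in \<open>I\<close> of a copy are seen, and on these the mean shift by \<open>t u\<close> agrees
    with the shift by \<open>t (\<Sigma> v\<^sub>I)\<close>, which is the shift of the standard normal vector by \<open>t A\<^sup>T v\<^sub>I\<close>.\<close>
  have obs_shift: "obs (t *\<^sub>R u) \<omega> = obs 0 (s t \<omega>)" for t \<omega>
    unfolding obs_def
  proof (rule observe_cong)
    fix I j i assume c: "(I, j) \<in> ?C" and i: "i \<in> I"
    have "(\<Sum>r\<in>UNIV. A i r * (\<omega> (I, j) r + t * h (I, j) r))
        = (\<Sum>r\<in>UNIV. A i r * \<omega> (I, j) r) + t * (\<Sum>r\<in>UNIV. A i r * h (I, j) r)"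
      unfolding sum_distrib_left sum.distrib[symmetric] by (intro sum.cong refl) (simp add: algebra_simps)
    also have "(\<Sum>r\<in>UNIV. A i r * h (I, j) r) = u $ i"
      using c i by (simp add: h_shift v copies_def)
    finally show "(\<lambda>c\<in>?C. gauss_affine A (t *\<^sub>R u) (\<omega> c)) (I, j) $ i
        = (\<lambda>c\<in>?C. gauss_affine A 0 (s t \<omega> c)) (I, j) $ i"
      using c by (simp add: gauss_affine_def s_def)
  qed
  have density: "distr \<Gamma> \<Gamma> (s t) = density \<Gamma> (\<lambda>\<omega>. ennreal (exp (t * T \<omega> - t\<^sup>2 * J / 2)))" for t
  proof -
    have "distr \<Gamma> \<Gamma> (s t) = density \<Gamma> (\<lambda>\<omega>. \<Prod>c\<in>?C. ennreal (exp (\<Sum>r\<in>UNIV. (t * h c r) * \<omega> c r - (t * h c r)\<^sup>2 / 2)))"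
      unfolding \<Gamma>_def s_def
    proof (rule distr_PiM_eq_density)
      fix c
      show "distr gauss gauss (\<lambda>z. \<lambda>r\<in>UNIV. z r + t * h c r)
          = density gauss (\<lambda>z. ennreal (exp (\<Sum>r\<in>UNIV. (t * h c r) * z r - (t * h c r)\<^sup>2 / 2)))"
        by (rule distr_gauss_shift)
      show "(\<lambda>z. \<lambda>r\<in>UNIV. z r + t * h c r) \<in> measurable gauss gauss"
        by (rule gauss_shift_measurable)
      show "(\<lambda>z. ennreal (exp (\<Sum>r\<in>UNIV. (t * h c r) * z r - (t * h c r)\<^sup>2 / 2))) \<in> borel_measurable gauss"
        using gauss_component_measurable by measurable
    qed (simp_all add: prob_space_gauss)
    moreover have "(\<Sum>c\<in>?C. \<Sum>r\<in>UNIV. (t * h c r) * \<omega> c r - (t * h c r)\<^sup>2 / 2) = t * T \<omega> - t\<^sup>2 * J / 2" for \<omega>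
      unfolding T_def J_eq[symmetric]
      by (simp add: sum_subtractf sum_distrib_left sum_divide_distrib power_mult_distrib mult.assoc)
    ultimately show ?thesis by (simp add: prod_ennreal exp_sum[symmetric])
  qed
  have s_meas: "s t \<in> measurable \<Gamma> \<Gamma>" for t
  proof -
    have "s t \<in> measurable \<Gamma> (PiM ?C (\<lambda>_. gauss))"
      unfolding s_def by (intro measurable_restrict measurable_compose[OF comp gauss_shift_measurable])
    then show ?thesis by (simp add: \<Gamma>_def)
  qed
  have mse: "mse \<I> a n f (distr gauss borel (gauss_affine A (t *\<^sub>R u)))
      = (\<integral>\<^sup>+\<omega>. ennreal ((g \<omega> - t)\<^sup>2) * ennreal (exp (t * T \<omega> - t\<^sup>2 * J / 2)) \<partial>\<Gamma>)" for t
  proof -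
    let ?P = "distr gauss borel (gauss_affine A (t *\<^sub>R u))"
    have "copies_law \<I> n ?P = distr \<Gamma> (PiM ?C (\<lambda>_. borel)) (\<lambda>\<omega>. \<lambda>c\<in>?C. gauss_affine A (t *\<^sub>R u) (\<omega> c))"
      unfolding copies_law_def \<Gamma>_def
      by (intro distr_PiM_componentwise[symmetric] prob_space_gauss gauss_affine_measurable finite_copies)
    moreover have "a \<bullet> mean_vec ?P = t" by (simp add: gauss_affine_law(1)[OF A] au)
    moreover have "(\<lambda>\<omega>. f (observe \<I> n \<omega>)) \<in> borel_measurable (PiM ?C (\<lambda>_. borel))"
      by (rule measurable_compose[OF observe_measurable f])
    ultimately have "mse \<I> a n f ?P = (\<integral>\<^sup>+\<omega>. ennreal ((f (obs (t *\<^sub>R u) \<omega>) - t)\<^sup>2) \<partial>\<Gamma>)"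
      unfolding mse_def obs_def by (simp add: nn_integral_distr[OF affine_meas])
    also have "\<dots> = (\<integral>\<^sup>+\<omega>. ennreal ((g (s t \<omega>) - t)\<^sup>2) \<partial>\<Gamma>)"
      by (simp add: obs_shift g_def)
    also have "\<dots> = (\<integral>\<^sup>+\<omega>. ennreal ((g \<omega> - t)\<^sup>2) \<partial>distr \<Gamma> \<Gamma> (s t))"
      using obs_meas[of 0] by (subst nn_integral_distr[OF s_meas]) (simp_all add: g_def)
    also have "\<dots> = (\<integral>\<^sup>+\<omega>. ennreal (exp (t * T \<omega> - t\<^sup>2 * J / 2)) * ennreal ((g \<omega> - t)\<^sup>2) \<partial>\<Gamma>)"
      unfolding density using T_meas obs_meas[of 0] by (intro nn_integral_density) (simp_all add: g_def)
    finally show ?thesis by (simp add: mult.commute)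
  qed
  show ?thesis
    unfolding J_def[symmetric]
  proof (rule gaussian_shift_minimax)
    show "prob_space \<Gamma>" "T \<in> borel_measurable \<Gamma>" "0 \<le> J" "0 < \<epsilon>"
      by (rule \<Gamma>.prob_space_axioms T_meas J_nonneg \<epsilon>)+
    show "g \<in> borel_measurable \<Gamma>" unfolding g_def by (rule obs_meas)
    fix t
    \<comment> \<open>The likelihood ratio is the density of the shifted noise law, a probability
      measure, so it integrates to 1.\<close>
    have "emeasure (distr \<Gamma> \<Gamma> (s t)) (space \<Gamma>) = 1"
      using \<Gamma>.prob_space_distr[OF s_meas[of t]] prob_space.emeasure_space_1 by fastforce
    then show "(\<integral>\<^sup>+\<omega>. ennreal (exp (t * T \<omega> - t\<^sup>2 * J / 2)) \<partial>\<Gamma>) = 1"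
      unfolding density using T_meas by (simp add: emeasure_density cong: nn_integral_cong)
    show "(\<integral>\<^sup>+\<omega>. ennreal ((g \<omega> - t)\<^sup>2) * ennreal (exp (t * T \<omega> - t\<^sup>2 * J / 2)) \<partial>\<Gamma>)
        \<le> (SUP P\<in>dists_cov \<Sigma>. mse \<I> a n f P)"
      unfolding mse[symmetric] by (intro SUP_upper gauss_affine_law(2)[OF A])
  qed
qed

section \<open>Minimax risk and allocation\<close>

lemma supported_quadratic_form:
  fixes l :: "real^'k::finite"
  assumes "\<And>i. i \<notin> I \<Longrightarrow> l $ i = 0"
  shows "(\<Sum>i\<in>I. \<Sum>j\<in>I. l $ i * S $ i $ j * l $ j) = l \<bullet> (S *v l)"
proof -
  have "(\<Sum>i\<in>I. \<Sum>j\<in>I. l $ i * S $ i $ j * l $ j) = (\<Sum>i\<in>I. \<Sum>j\<in>UNIV. l $ i * S $ i $ j * l $ j)"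
    using assms by (intro sum.cong refl sum.mono_neutral_left) simp_all
  also have "\<dots> = (\<Sum>i\<in>UNIV. \<Sum>j\<in>UNIV. l $ i * S $ i $ j * l $ j)"
    using assms by (intro sum.mono_neutral_left) simp_all
  finally show ?thesis
    by (simp add: inner_vec_def matrix_vector_mult_def sum_distrib_left mult.assoc)
qed

text \<open>Lets the prior become flat in the Bayes bound.\<close>

lemma ennreal_inverse_le_limit:
  assumes J: "0 < J" and b: "\<And>\<epsilon>. 0 < \<epsilon> \<Longrightarrow> ennreal (1 / (J + \<epsilon>)) \<le> b"
  shows "ennreal (1 / J) \<le> b"
proof (rule tendsto_upperbound)
  have "((\<lambda>\<epsilon>. 1 / (J + \<epsilon>)) \<longlongrightarrow> 1 / (J + 0)) (at_right 0)"
    using J by (intro tendsto_intros) auto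
  then show "((\<lambda>\<epsilon>. ennreal (1 / (J + \<epsilon>))) \<longlongrightarrow> ennreal (1 / J)) (at_right 0)"
    by (intro tendsto_ennrealI) simp
  show "\<forall>\<^sub>F \<epsilon> in at_right 0. ennreal (1 / (J + \<epsilon>)) \<le> b"
    using b eventually_at_right_less[of 0] by (rule eventually_mono[rotated])
qed simp

context posdef_matrix
begin

text \<open>With \<open>s = S_mat \<I> \<Sigma> n *v a\<close> the value is the information form at
  \<open>s\<close>. It is positive because \<open>info \<I> n *v s = a\<close> is nonzero, so some
  observed \<open>K I *v s\<close> is nonzero.\<close>

lemma S_mat_pos:
  assumes cov: "covers_supp \<I> a n" and a: "a \<noteq> 0"
  shows "0 < a \<bullet> (S_mat \<I> \<Sigma> n *v a)"
proof -
  define s where "s = S_mat \<I> \<Sigma> n *v a"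
  have F: "info \<I> n *v s = a" using info_S_mat[OF cov] by (simp add: s_def)
  have "\<exists>I\<in>\<I>. 0 < n I \<and> K I *v s \<noteq> 0"
  proof (rule ccontr)
    assume "\<not> ?thesis"
    then have "info \<I> n *v s = 0" unfolding info_vec by (intro sum.neutral) auto
    with F a show False by simp
  qed
  then have "0 < s \<bullet> (info \<I> n *v s)" using info_pos by blast
  then have "0 < s \<bullet> a" by (simp add: F)
  then show ?thesis by (simp add: s_def inner_commute)
qed

lemma S_mat_attained:
  assumes cov: "covers_supp \<I> a n"
  obtains lam where "weights_ok \<I> lam" "unbiased_ok \<I> a n lam"
    "ppi_obj \<I> \<Sigma> n lam = a \<bullet> (S_mat \<I> \<Sigma> n *v a)"
proof
  define s where "s = S_mat \<I> \<Sigma> n *v a"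
  \<comment> \<open>Stationarity of the objective under the unbiasedness constraint says that
    \<open>\<Sigma>\<close> applied to the weights of \<open>I\<close>, divided by
    \<open>n I\<close>, agrees on \<open>I\<close> with a common multiplier. Solving this with
    multiplier \<open>s\<close> gives these weights.\<close>
  let ?lam = "\<lambda>I. real (n I) *\<^sub>R (K I *v s)"
  have F: "info \<I> n *v s = a" using info_S_mat[OF cov] by (simp add: s_def)
  show "weights_ok \<I> ?lam" by (simp add: weights_ok_def K_supported)
  have "(\<Sum>I\<in>{I\<in>\<I>. 0 < n I}. ?lam I) = (\<Sum>I\<in>\<I>. ?lam I)"
    by (rule sum.mono_neutral_left) auto
  then show "unbiased_ok \<I> a n ?lam" using F by (simp add: unbiased_ok_def info_vec)
  have "ppi_obj \<I> \<Sigma> n ?lam = (\<Sum>I\<in>{I\<in>\<I>. 0 < n I}. real (n I) * (s \<bullet> (K I *v s)))"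
    unfolding ppi_obj_def
  proof (intro sum.cong refl)
    fix I assume I: "I \<in> {I\<in>\<I>. 0 < n I}"
    have "(\<Sum>i\<in>I. \<Sum>j\<in>I. ?lam I $ i * \<Sigma> $ i $ j * ?lam I $ j) = ?lam I \<bullet> (\<Sigma> *v ?lam I)"
      by (rule supported_quadratic_form) (simp add: K_supported)
    also have "\<dots> = (real (n I))\<^sup>2 * (s \<bullet> (K I *v s))"
      by (simp add: matrix_vector_mult_scaleR K_quadratic_form power2_eq_square)
    finally show "1 / real (n I) * (\<Sum>i\<in>I. \<Sum>j\<in>I. ?lam I $ i * \<Sigma> $ i $ j * ?lam I $ j)
        = real (n I) * (s \<bullet> (K I *v s))"
      using I by (simp add: power2_eq_square)
  qed
  also have "\<dots> = s \<bullet> (info \<I> n *v s)"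
    unfolding info_quadratic_form by (rule sum.mono_neutral_left) auto
  finally have "ppi_obj \<I> \<Sigma> n ?lam = a \<bullet> s" by (simp add: F inner_commute)
  then show "ppi_obj \<I> \<Sigma> n ?lam = a \<bullet> (S_mat \<I> \<Sigma> n *v a)" by (simp add: s_def)
qed

lemma minimax_ge_S_mat:
  assumes f: "f \<in> borel_measurable (PiM (obs_idx \<I> n) (\<lambda>_. borel))"
    and cov: "covers_supp \<I> a n" and a: "a \<noteq> 0"
  shows "ennreal (a \<bullet> (S_mat \<I> \<Sigma> n *v a)) \<le> (SUP P\<in>dists_cov \<Sigma>. mse \<I> a n f P)"
proof -
  define s where "s = S_mat \<I> \<Sigma> n *v a"
  define q where "q = a \<bullet> s"
  \<comment> \<open>The least favourable direction: by Cauchy-Schwarz for the information form,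
    \<open>1 / q\<close> is the smallest information among directions with
    \<open>a \<bullet> u = 1\<close>.\<close>
  define u where "u = (1 / q) *\<^sub>R s"
  have q: "0 < q" using S_mat_pos[OF cov a] by (simp add: q_def s_def)
  have F: "info \<I> n *v s = a" using info_S_mat[OF cov] by (simp add: s_def)
  have J: "(\<Sum>I\<in>\<I>. real (n I) * ((K I *v u) \<bullet> (\<Sigma> *v (K I *v u)))) = 1 / q"
  proof -
    have "(\<Sum>I\<in>\<I>. real (n I) * ((K I *v u) \<bullet> (\<Sigma> *v (K I *v u)))) = u \<bullet> (info \<I> n *v u)"
      by (simp add: K_quadratic_form info_quadratic_form)
    also have "\<dots> = (1 / q) * (1 / q) * (s \<bullet> a)"
      by (simp add: u_def matrix_vector_mult_scaleR F)
    finally show ?thesis using q by (simp add: q_def inner_commute)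
  qed
  have "ennreal (1 / (1 / q + \<epsilon>)) \<le> (SUP P\<in>dists_cov \<Sigma>. mse \<I> a n f P)" if "0 < \<epsilon>" for \<epsilon>
    unfolding J[symmetric] using q that
    by (intro minimax_lower_bound[OF f, of a u] Sigma_K) (simp_all add: u_def q_def[symmetric])
  then have "ennreal (1 / (1 / q)) \<le> (SUP P\<in>dists_cov \<Sigma>. mse \<I> a n f P)"
    using ennreal_inverse_le_limit[of "1 / q"] q by simp
  then show ?thesis by (simp add: q_def s_def)
qed

text \<open>Moving the mean along an unobserved coordinate \<open>i\<close> leaves the law of the
  data unchanged while the target varies. Thus \<open>J = 0\<close>, and the prior precision
  \<open>1 / y\<close> gives the lower bound \<open>y\<close> for every positive
  \<open>y\<close>.\<close>

lemma minimax_not_covered: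
  assumes f: "f \<in> borel_measurable (PiM (obs_idx \<I> n) (\<lambda>_. borel))"
    and cov: "\<not> covers_supp \<I> a n"
  shows "(SUP P\<in>dists_cov \<Sigma>. mse \<I> a n f P) = \<top>"
proof -
  obtain i where i: "a $ i \<noteq> 0" "\<And>I. I \<in> \<I> \<Longrightarrow> 0 < n I \<Longrightarrow> i \<notin> I"
    using cov unfolding covers_supp_def by blast
  have "ennreal y \<le> (SUP P\<in>dists_cov \<Sigma>. mse \<I> a n f P)" if "0 < y" for y
  proof -
    have "a \<bullet> axis i (1 / a $ i) = 1" using i(1) by (simp add: inner_axis)
    moreover have "(\<Sigma> *v 0) $ l = axis i (1 / a $ i) $ l" if "I \<in> \<I>" "0 < n I" "l \<in> I" for I l
      using i(2) that by (auto simp: axis_def)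
    ultimately show ?thesis
      using minimax_lower_bound[OF f, where v = "\<lambda>_. 0" and \<epsilon> = "1 / y"] \<open>0 < y\<close> by fastforce
  qed
  then have "of_nat k \<le> (SUP P\<in>dists_cov \<Sigma>. mse \<I> a n f P)" for k
    by (cases "k = 0") (auto simp: ennreal_of_nat_eq_real_of_nat)
  then show ?thesis
    using ennreal_Ex_less_of_nat by (metis linorder_not_less top.not_eq_extremum)
qed

section \<open>Comparison of estimators and weights with \<open>V_B\<close>\<close>

lemma V_B_bdd_below:
  assumes "a \<noteq> 0"
  shows "bdd_below {a \<bullet> (S_mat \<I> \<Sigma> n *v a) | n. budget_ok \<I> c B n \<and> covers_supp \<I> a n}"
  using S_mat_pos[OF _ assms] by (intro bdd_belowI[of _ 0]) (auto intro: less_imp_le)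

lemma V_B_le:
  assumes "a \<noteq> 0" "budget_ok \<I> c B n" "covers_supp \<I> a n"
  shows "V_B \<I> c B \<Sigma> a \<le> a \<bullet> (S_mat \<I> \<Sigma> n *v a)"
  unfolding V_B_def using assms by (intro cInf_lower V_B_bdd_below) auto

text \<open>The infimum \<open>V_B\<close> ranges over covering allocations only; the others are
  harmless because their maximal risk is infinite.\<close>

lemma minimax_ge_V_B:
  assumes a: "a \<noteq> 0" and nf: "(n, f) \<in> budget_estimators \<I> c B"
  shows "ennreal (V_B \<I> c B \<Sigma> a) \<le> (SUP P\<in>dists_cov \<Sigma>. mse \<I> a n f P)"
proof (cases "covers_supp \<I> a n")
  case True
  have "ennreal (V_B \<I> c B \<Sigma> a) \<le> ennreal (a \<bullet> (S_mat \<I> \<Sigma> n *v a))"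
    using nf True a by (intro ennreal_leI V_B_le) (auto simp: budget_estimators_def)
  also have "\<dots> \<le> (SUP P\<in>dists_cov \<Sigma>. mse \<I> a n f P)"
    using nf True a by (intro minimax_ge_S_mat) (auto simp: budget_estimators_def)
  finally show ?thesis .
next
  case False
  have "(SUP P\<in>dists_cov \<Sigma>. mse \<I> a n f P) = \<top>"
    using nf False by (intro minimax_not_covered) (simp_all add: budget_estimators_def)
  then show ?thesis by (simp only: top_greatest)
qed

lemma ppi_obj_nonneg:
  assumes "weights_ok \<I> lam"
  shows "0 \<le> ppi_obj \<I> \<Sigma> n lam"
  unfolding ppi_obj_def
proof (rule sum_nonneg)
  fix I assume "I \<in> {I\<in>\<I>. 0 < n I}"
  then have "(\<Sum>i\<in>I. \<Sum>j\<in>I. lam I $ i * \<Sigma> $ i $ j * lam I $ j) = lam I \<bullet> (\<Sigma> *v lam I)"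
    using assms by (intro supported_quadratic_form) (auto simp: weights_ok_def)
  then show "0 \<le> 1 / real (n I) * (\<Sum>i\<in>I. \<Sum>j\<in>I. lam I $ i * \<Sigma> $ i $ j * lam I $ j)"
    using posdef[of "lam I"] by (cases "lam I = 0") auto
qed

lemma minimax_le_ppi_obj:
  assumes "ppi_feasible \<I> c B a n lam"
  shows "(n, theta_est \<I> n lam) \<in> budget_estimators \<I> c B"
    and "(SUP P\<in>dists_cov \<Sigma>. mse \<I> a n (theta_est \<I> n lam) P) \<le> ennreal (ppi_obj \<I> \<Sigma> n lam)"
  using assms by (auto simp: ppi_feasible_def budget_estimators_def theta_est_measurable mse_theta_est intro!: SUP_least)

text \<open>Instead of optimising the weights for a fixed allocation, the argument reads a feasible
  pair as an estimator and applies the minimax bound to it. Nonnegativity of the objective permits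
  the return to real numbers.\<close>

lemma V_B_le_ppi_obj:
  assumes a: "a \<noteq> 0" and feas: "ppi_feasible \<I> c B a n lam"
  shows "V_B \<I> c B \<Sigma> a \<le> ppi_obj \<I> \<Sigma> n lam"
proof -
  have "ennreal (V_B \<I> c B \<Sigma> a) \<le> ennreal (ppi_obj \<I> \<Sigma> n lam)"
    using minimax_ge_V_B[OF a minimax_le_ppi_obj(1)[OF feas]] minimax_le_ppi_obj(2)[OF feas]
    by (rule order_trans)
  then show ?thesis
    using ppi_obj_nonneg[of \<I> lam n] feas by (simp add: ppi_feasible_def)
qed

end

theorem theorem1:
  fixes \<I> :: "'k::finite set set"
    and c :: "'k set \<Rightarrow> real^'m::finite"
    and B :: "real^'m"
    and \<Sigma> :: "real^'k^'k"
    and a :: "real^'k"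
  assumes a_nz: "a \<noteq> 0"
    and I_ne: "\<forall>I\<in>\<I>. I \<noteq> {}"
    and c_nonneg: "\<forall>I\<in>\<I>. \<forall>m. 0 \<le> c I $ m"
    and B_nonneg: "\<forall>m. 0 \<le> B $ m"
    and sym: "transpose \<Sigma> = \<Sigma>"
    and posdef: "\<forall>x. x \<noteq> 0 \<longrightarrow> 0 < x \<bullet> (\<Sigma> *v x)"
    and feasible: "\<exists>n. budget_ok \<I> c B n \<and> covers_supp \<I> a n"
  shows "(INF nf\<in>budget_estimators \<I> c B. SUP P\<in>dists_cov \<Sigma>. mse \<I> a (fst nf) (snd nf) P)
           = ennreal (V_B \<I> c B \<Sigma> a) \<and>
         (\<forall>n lam. multippi_opt \<I> c B \<Sigma> a n lam \<longrightarrow>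
           (\<forall>P\<in>dists_cov \<Sigma>. prob_space.variance (copies_law \<I> n P) (theta_hat \<I> n lam)
               = V_B \<I> c B \<Sigma> a))"
proof (intro conjI allI impI ballI)
  interpret posdef_matrix \<Sigma> using sym posdef by unfold_locales auto
  let ?R = "INF nf\<in>budget_estimators \<I> c B. SUP P\<in>dists_cov \<Sigma>. mse \<I> a (fst nf) (snd nf) P"
  let ?V = "{a \<bullet> (S_mat \<I> \<Sigma> n *v a) | n. budget_ok \<I> c B n \<and> covers_supp \<I> a n}"
  have V: "?V \<noteq> {}" "V_B \<I> c B \<Sigma> a = Inf ?V" using feasible by (auto simp: V_B_def)
  have V_nonneg: "0 \<le> V_B \<I> c B \<Sigma> a"
    unfolding V(2) using V(1) S_mat_pos[OF _ a_nz] by (intro cInf_greatest) (auto intro: less_imp_le)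
  have attained: "\<exists>lam. ppi_feasible \<I> c B a n lam \<and> ppi_obj \<I> \<Sigma> n lam = a \<bullet> (S_mat \<I> \<Sigma> n *v a)"
    if "budget_ok \<I> c B n" "covers_supp \<I> a n" for n
    using S_mat_attained[OF that(2)] that(1) by (metis ppi_feasible_def)
  show "?R = ennreal (V_B \<I> c B \<Sigma> a)"
  proof (rule antisym)
    show "ennreal (V_B \<I> c B \<Sigma> a) \<le> ?R"
      using minimax_ge_V_B[OF a_nz] by (intro INF_greatest) auto
    show "?R \<le> ennreal (V_B \<I> c B \<Sigma> a)"
    \<comment> \<open>\<open>V_B\<close> is defined as an infimum, so an allocation within
      \<open>e\<close> of it takes the place of a minimiser.\<close>
    proof (rule ennreal_le_epsilon)
      fix e :: real
      assume e: "0 < e"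
      then obtain n where n: "budget_ok \<I> c B n" "covers_supp \<I> a n"
        "a \<bullet> (S_mat \<I> \<Sigma> n *v a) < V_B \<I> c B \<Sigma> a + e"
        using cInf_lessD[OF V(1), of "V_B \<I> c B \<Sigma> a + e"] V(2) by auto
      obtain lam where lam: "ppi_feasible \<I> c B a n lam" "ppi_obj \<I> \<Sigma> n lam = a \<bullet> (S_mat \<I> \<Sigma> n *v a)"
        using attained[OF n(1,2)] by blast
      have "?R \<le> (SUP P\<in>dists_cov \<Sigma>. mse \<I> a n (theta_est \<I> n lam) P)"
        using INF_lower[OF minimax_le_ppi_obj(1)[OF lam(1)], of "\<lambda>nf. SUP P\<in>dists_cov \<Sigma>. mse \<I> a (fst nf) (snd nf) P"]
        by simp
      also have "\<dots> \<le> ennreal (ppi_obj \<I> \<Sigma> n lam)" by (rule minimax_le_ppi_obj(2)[OF lam(1)])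
      also have "\<dots> \<le> ennreal (V_B \<I> c B \<Sigma> a + e)" using n(3) lam(2) by (intro ennreal_leI) simp
      finally show "?R \<le> ennreal (V_B \<I> c B \<Sigma> a) + ennreal e" using V_nonneg e by simp
    qed
  qed
  fix n lam P
  assume opt: "multippi_opt \<I> c B \<Sigma> a n lam" and P: "P \<in> dists_cov \<Sigma>"
  \<comment> \<open>An optimal pair competes with the weights from \<open>attained\<close> for each
    covering allocation, so its objective is a lower bound of \<open>?V\<close>.\<close>
  have "ppi_obj \<I> \<Sigma> n lam \<le> V_B \<I> c B \<Sigma> a"
    unfolding V(2)
  proof (rule cInf_greatest[OF V(1)])
    fix y assume "y \<in> ?V"
    then show "ppi_obj \<I> \<Sigma> n lam \<le> y"
      using attained opt unfolding multippi_opt_def by force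
  qed
  moreover have "V_B \<I> c B \<Sigma> a \<le> ppi_obj \<I> \<Sigma> n lam"
    using opt by (intro V_B_le_ppi_obj[OF a_nz]) (simp add: multippi_opt_def)
  ultimately show "prob_space.variance (copies_law \<I> n P) (theta_hat \<I> n lam) = V_B \<I> c B \<Sigma> a"
    by (simp add: theta_hat_variance[OF P])
qed

end
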